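(* Let $S$ be an irreducible perfect scheme over $k$ and let $X$ be a special formal $\mathcal O_D$-module over $S$. Then $X$ admits a critical index, i.e. there is $i\in\mathbb Z/d$ with $\Pi_i=0$ on $S$.
   Context: $p$ is a prime, $E$ a finite extension of $\mathbb Q_p$ with ring of integers $\mathcal O$, uniformizer $\varpi$, residue field $\mathbb F_q$; $\breve{\mathcal O}$ is the ring of integers of the completed maximal unramified extension of $E$, with residue field $k=\overline{\mathbb F}_q$. Fix $d\ge2$; $E_d$ unramified of degree $d$ over $E$ with integers $\mathcal O_d$, $\sigma$ the generator of $\mathrm{Gal}(E_d/E)$ lifting $x\mapsto x^q$; $\mathcal O_D$ is the ring generated by $\mathcal O_d$ and an element $\Pi$ with $\Pi^d=\varpi$, $\Pi a=\sigma(a)\Pi$. A special formal $\mathcal O_D$-module over a scheme $S$ over $\breve{\mathcal O}$ on which $p$ is locally nilpotent is a formal $p$-divisible group $X$ over $S$ with a ring map $\mathcal O_D\to\mathrm{End}_S(X)$ such that $\mathcal O$ acts on $\mathrm{Lie}(X)$ through $\mathcal O\to\mathcal O_S$ and, in the decomposition $\mathrm{Lie}(X)=\bigoplus_{i\in\mathbb Z/d}\mathrm{Lie}(X)_i$ given by the $\mathcal O_d$-action (with $\mathcal O_d$ acting on the $i$-th piece via $\psi_0\circ\sigma^i$ for a fixed embedding $\psi_0$ of $\mathcal O_d$ into $\breve{\mathcal O}$), each $\mathrm{Lie}(X)_i$ is an invertible $\mathcal O_S$-module. The action of $\Pi$ induces $\mathcal O_S$-linear maps $\Pi_i:\mathrm{Lie}(X)_i\to\mathrm{Lie}(X)_{i+1}$;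 $i$ is a critical index if $\Pi_i=0$. *)

theory Defs
  imports
    "HOL-Analysis.Analysis"
    "HOL-Algebra.Algebra"
    "HOL-Algebra.Algebraic_Closure"
begin

section \<open>Arithmetic data\<close>

text \<open>The completion of \<open>R\<close> with respect to the powers of the principal ideal of \<open>t\<close>, i.e. the
  inverse limit of the rings \<open>R/(t^n)\<close>. A point is a sequence of cosets; compatibility of
  consecutive terms is inclusion of cosets.\<close>

definition adic_completion :: "('a, 'm) ring_scheme \<Rightarrow> 'a \<Rightarrow> (nat \<Rightarrow> 'a set) ring" where
  "adic_completion R t =
    (let Q = (\<lambda>n::nat. R Quot (PIdl\<^bsub>R\<^esub> (t [^]\<^bsub>R\<^esub> n))) in
     \<lparr>carrier = {x. \<forall>n. x n \<in> carrier (Q n) \<and> x (Suc n) \<subseteq> x n},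
      monoid.mult = (\<lambda>x y n. x n \<otimes>\<^bsub>Q n\<^esub> y n),
      one = (\<lambda>n. \<one>\<^bsub>Q n\<^esub>),
      ring.zero = (\<lambda>n. \<zero>\<^bsub>Q n\<^esub>),
      add = (\<lambda>x y n. x n \<oplus>\<^bsub>Q n\<^esub> y n)\<rparr>)"

definition to_completion :: "('a, 'm) ring_scheme \<Rightarrow> 'a \<Rightarrow> 'a \<Rightarrow> nat \<Rightarrow> 'a set" where
  "to_completion R t x = (\<lambda>n. PIdl\<^bsub>R\<^esub> (t [^]\<^bsub>R\<^esub> n) +>\<^bsub>R\<^esub> x)"

definition Zp :: "nat \<Rightarrow> (nat \<Rightarrow> int set) ring" where
  "Zp p = adic_completion \<Z> (int p)"

text \<open>In the following, \<open>M\<close> is an ambient field and \<open>z\<close> an embedding of \<open>Zp p\<close> into \<open>M\<close>.\<close>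

definition Qp_in ::
  "nat \<Rightarrow> 'm ring \<Rightarrow> ((nat \<Rightarrow> int set) \<Rightarrow> 'm) \<Rightarrow> 'm set" where
  "Qp_in p M z = {z x \<otimes>\<^bsub>M\<^esub> inv\<^bsub>M\<^esub> (z y) | x y.
     x \<in> carrier (Zp p) \<and> y \<in> carrier (Zp p) \<and> y \<noteq> \<zero>\<^bsub>Zp p\<^esub>}"

definition integral_over :: "'m ring \<Rightarrow> 'm set \<Rightarrow> 'm \<Rightarrow> bool" where
  "integral_over M B x \<longleftrightarrow> (\<exists>(n::nat) c. c \<in> {..<n} \<rightarrow> B \<and>
     x [^]\<^bsub>M\<^esub> n \<oplus>\<^bsub>M\<^esub> (\<Oplus>\<^bsub>M\<^esub>i\<in>{..<n}. c i \<otimes>\<^bsub>M\<^esub> x [^]\<^bsub>M\<^esub> i) = \<zero>\<^bsub>M\<^esub>)"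

definition integers ::
  "nat \<Rightarrow> 'm ring \<Rightarrow> ((nat \<Rightarrow> int set) \<Rightarrow> 'm) \<Rightarrow> 'm set \<Rightarrow> 'm ring" where
  "integers p M z F =
     M\<lparr>carrier := {x \<in> F. x \<in> carrier M \<and> integral_over M (z ` carrier (Zp p)) x}\<rparr>"

definition uniformizer :: "'m ring \<Rightarrow> 'm \<Rightarrow> bool" where
  "uniformizer A w \<longleftrightarrow> w \<in> carrier A \<and> maximalideal (PIdl\<^bsub>A\<^esub> w) A"

text \<open>Finite residue fields are perfect, so unramified just means that a uniformizer of the
  base stays a uniformizer.\<close>

definition finite_unramified ::
  "nat \<Rightarrow> 'm ring \<Rightarrow> ((nat \<Rightarrow> int set) \<Rightarrow> 'm) \<Rightarrow> 'm set \<Rightarrow> 'm \<Rightarrow> 'm set \<Rightarrow> bool" where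
  "finite_unramified p M z E w F \<longleftrightarrow>
     subfield F M \<and> E \<subseteq> F \<and> ring.finite_dimension M E F \<and> uniformizer (integers p M z F) w"

definition max_unramified ::
  "nat \<Rightarrow> 'm ring \<Rightarrow> ((nat \<Rightarrow> int set) \<Rightarrow> 'm) \<Rightarrow> 'm set \<Rightarrow> 'm \<Rightarrow> 'm set" where
  "max_unramified p M z E w = generate_field M (\<Union>{F. finite_unramified p M z E w F})"

definition O_breve ::
  "nat \<Rightarrow> 'm ring \<Rightarrow> ((nat \<Rightarrow> int set) \<Rightarrow> 'm) \<Rightarrow> 'm set \<Rightarrow> 'm \<Rightarrow> (nat \<Rightarrow> 'm set) ring" where
  "O_breve p M z E w = adic_completion (integers p M z (max_unramified p M z E w)) w"

definition to_O_breve ::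
  "nat \<Rightarrow> 'm ring \<Rightarrow> ((nat \<Rightarrow> int set) \<Rightarrow> 'm) \<Rightarrow> 'm set \<Rightarrow> 'm \<Rightarrow> 'm \<Rightarrow> nat \<Rightarrow> 'm set" where
  "to_O_breve p M z E w = to_completion (integers p M z (max_unramified p M z E w)) w"

definition field_auts :: "'m ring \<Rightarrow> 'm set \<Rightarrow> 'm set \<Rightarrow> ('m \<Rightarrow> 'm) set" where
  "field_auts M E F = {s \<in> ring_iso (M\<lparr>carrier := F\<rparr>) (M\<lparr>carrier := F\<rparr>). \<forall>x\<in>E. s x = x}"

text \<open>The parameters are: the prime \<open>p\<close>; an algebraic closure \<open>M\<close> of the field \<open>E\<close>, with an
  embedding \<open>z\<close> of the p-adic integers; the uniformizer \<open>w\<close>; the unramified extension \<open>Ed\<close> of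
  degree \<open>d\<close> with its Frobenius \<open>\<sigma>\<close>; the embedding \<open>\<psi>\<close> of its integers into \<open>O_breve\<close>; the order
  \<open>OD\<close>, which is free over the image of the integers of \<open>Ed\<close> (embedded by \<open>j\<close>) on the powers
  below \<open>d\<close> of the element \<open>v\<close>, usually written \<open>\<Pi>\<close>; and the residue field \<open>k\<close> of \<open>O_breve\<close> with the reduction map \<open>red\<close>.\<close>

locale drinfeld_data =
  fixes p :: nat
    and M :: "'m ring"
    and z :: "(nat \<Rightarrow> int set) \<Rightarrow> 'm"
    and E :: "'m set"
    and w :: 'm
    and d :: nat
    and Ed :: "'m set"
    and \<sigma> :: "'m \<Rightarrow> 'm"
    and \<psi> :: "'m \<Rightarrow> nat \<Rightarrow> 'm set"
    and OD :: "'e ring"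
    and j :: "'m \<Rightarrow> 'e"
    and v :: 'e
    and k :: "'k ring"
    and red :: "(nat \<Rightarrow> 'm set) \<Rightarrow> 'k"
  assumes prime_p: "Factorial_Ring.prime p"
    and z_hom: "z \<in> ring_hom (Zp p) M"
    and z_inj: "inj_on z (carrier (Zp p))"
    and M_closure: "algebraic_closure M E"
    and Qp_sub: "Qp_in p M z \<subseteq> E"
    and E_finite: "ring.finite_dimension M (Qp_in p M z) E"
    and w_unif: "uniformizer (integers p M z E) w"
    and d_ge2: "2 \<le> d"
    and Ed_unram: "finite_unramified p M z E w Ed"
    and Ed_degree: "ring.dimension M d E Ed"
    and sigma_aut: "\<sigma> \<in> field_auts M E Ed"
    and sigma_gen: "\<forall>\<tau> \<in> field_auts M E Ed. \<exists>i::nat. \<forall>x\<in>Ed. \<tau> x = (\<sigma> ^^ i) x"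
    and sigma_frob: "\<forall>x \<in> carrier (integers p M z Ed). \<exists>y \<in> carrier (integers p M z Ed).
          \<sigma> x = x [^]\<^bsub>M\<^esub> card (carrier (integers p M z E Quot (PIdl\<^bsub>integers p M z E\<^esub> w)))
                  \<oplus>\<^bsub>M\<^esub> w \<otimes>\<^bsub>M\<^esub> y"
    and psi_hom: "\<psi> \<in> ring_hom (integers p M z Ed) (O_breve p M z E w)"
    and psi_inj: "inj_on \<psi> (carrier (integers p M z Ed))"
    and psi_O: "\<forall>x \<in> carrier (integers p M z E). \<psi> x = to_O_breve p M z E w x"
    and OD_ring: "ring OD"
    and j_hom: "j \<in> ring_hom (integers p M z Ed) OD"
    and j_inj: "inj_on j (carrier (integers p M z Ed))"
    and v_in: "v \<in> carrier OD"
    and v_pow: "v [^]\<^bsub>OD\<^esub> d = j w"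
    and v_comm: "\<forall>a \<in> carrier (integers p M z Ed). v \<otimes>\<^bsub>OD\<^esub> j a = j (\<sigma> a) \<otimes>\<^bsub>OD\<^esub> v"
    and OD_free: "\<forall>x \<in> carrier OD. \<exists>!c. c \<in> {..<d} \<rightarrow>\<^sub>E carrier (integers p M z Ed) \<and>
          x = (\<Oplus>\<^bsub>OD\<^esub>i\<in>{..<d}. j (c i) \<otimes>\<^bsub>OD\<^esub> v [^]\<^bsub>OD\<^esub> i)"
    and k_field: "field k"
    and red_hom: "red \<in> ring_hom (O_breve p M z E w) k"
    and red_surj: "red ` carrier (O_breve p M z E w) = carrier k"
    and red_ker: "a_kernel (O_breve p M z E w) k red
          = Idl\<^bsub>O_breve p M z E w\<^esub> {to_O_breve p M z E w w}"


section \<open>Schemes\<close>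

record ('s, 'a) presheaf =
  Sec :: "'s set \<Rightarrow> 'a ring"
  Res :: "'s set \<Rightarrow> 's set \<Rightarrow> 'a \<Rightarrow> 'a"

record ('s, 'a) ringed_space = "('s, 'a) presheaf" +
  sp :: "'s topology"

definition presheaf_of_rings :: "'s topology \<Rightarrow> ('s, 'a, 'z) presheaf_scheme \<Rightarrow> bool" where
  "presheaf_of_rings T F \<longleftrightarrow>
     (\<forall>U. openin T U \<longrightarrow> cring (Sec F U)) \<and>
     (\<forall>U V. openin T U \<and> openin T V \<and> V \<subseteq> U \<longrightarrow> Res F U V \<in> ring_hom (Sec F U) (Sec F V)) \<and>
     (\<forall>U. openin T U \<longrightarrow> (\<forall>x \<in> carrier (Sec F U). Res F U U x = x)) \<and>
     (\<forall>U V W. openin T U \<and> openin T V \<and> openin T W \<and> W \<subseteq> V \<and> V \<subseteq> U \<longrightarrow>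
        (\<forall>x \<in> carrier (Sec F U). Res F V W (Res F U V x) = Res F U W x))"

definition sheaf_of_rings :: "'s topology \<Rightarrow> ('s, 'a, 'z) presheaf_scheme \<Rightarrow> bool" where
  "sheaf_of_rings T F \<longleftrightarrow> presheaf_of_rings T F \<and>
     (\<forall>\<U>. (\<forall>V\<in>\<U>. openin T V) \<longrightarrow>
       (\<forall>x.
          (\<forall>V\<in>\<U>. x V \<in> carrier (Sec F V)) \<and>
          (\<forall>V\<in>\<U>. \<forall>W\<in>\<U>. Res F V (V \<inter> W) (x V) = Res F W (V \<inter> W) (x W)) \<longrightarrow>
          (\<exists>!y. y \<in> carrier (Sec F (\<Union>\<U>)) \<and> (\<forall>V\<in>\<U>. Res F (\<Union>\<U>) V y = x V))))"

definition spec_topology :: "'a ring \<Rightarrow> 'a set topology" where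
  "spec_topology R =
     topology_generated_by {{P. primeideal P R \<and> f \<notin> P} | f. f \<in> carrier R}"

definition is_localization :: "'a ring \<Rightarrow> 'a \<Rightarrow> 'b ring \<Rightarrow> ('a \<Rightarrow> 'b) \<Rightarrow> bool" where
  "is_localization R f B h \<longleftrightarrow>
     h \<in> ring_hom R B \<and> h f \<in> Units B \<and>
     (\<forall>b \<in> carrier B. \<exists>r \<in> carrier R. \<exists>n::nat. b \<otimes>\<^bsub>B\<^esub> h f [^]\<^bsub>B\<^esub> n = h r) \<and>
     (\<forall>r \<in> carrier R. h r = \<zero>\<^bsub>B\<^esub> \<longrightarrow> (\<exists>n::nat. f [^]\<^bsub>R\<^esub> n \<otimes>\<^bsub>R\<^esub> r = \<zero>\<^bsub>R\<^esub>))"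

text \<open>\<open>U\<close> with the restricted sheaf is isomorphic to the spectrum of \<open>Sec S U\<close>: the structure sheaf
  of a spectrum is the sheaf whose sections over the basic open set of \<open>f\<close> are the localization
  at \<open>f\<close>.\<close>

definition affine_open :: "('s, 'a) ringed_space \<Rightarrow> 's set \<Rightarrow> bool" where
  "affine_open S U \<longleftrightarrow> openin (sp S) U \<and>
     (\<exists>\<phi>. homeomorphic_map (subtopology (sp S) U) (spec_topology (Sec S U)) \<phi> \<and>
       (\<forall>f \<in> carrier (Sec S U).
          is_localization (Sec S U) f (Sec S {s \<in> U. f \<notin> \<phi> s}) (Res S U {s \<in> U. f \<notin> \<phi> s})))"

definition is_scheme :: "('s, 'a) ringed_space \<Rightarrow> bool" where
  "is_scheme S \<longleftrightarrow> sheaf_of_rings (sp S) S \<and>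
     (\<forall>s \<in> topspace (sp S). \<exists>U. s \<in> U \<and> affine_open S U)"

abbreviation global_sections :: "('s, 'a) ringed_space \<Rightarrow> 'a ring" where
  "global_sections S \<equiv> Sec S (topspace (sp S))"

definition irreducible_space :: "'s topology \<Rightarrow> bool" where
  "irreducible_space T \<longleftrightarrow> topspace T \<noteq> {} \<and>
     (\<forall>C D. closedin T C \<and> closedin T D \<and> C \<union> D = topspace T \<longrightarrow>
        C = topspace T \<or> D = topspace T)"

text \<open>The absolute Frobenius is the identity on points, so it is an isomorphism iff it is
  bijective on sections.\<close>

definition perfect_scheme :: "nat \<Rightarrow> ('s, 'a) ringed_space \<Rightarrow> bool" where
  "perfect_scheme p S \<longleftrightarrow> is_scheme S \<and>
     add_pow (global_sections S) p \<one>\<^bsub>global_sections S\<^esub> = \<zero>\<^bsub>global_sections S\<^esub> \<and>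
     (\<forall>U. openin (sp S) U \<longrightarrow>
        bij_betw (\<lambda>x. x [^]\<^bsub>Sec S U\<^esub> p) (carrier (Sec S U)) (carrier (Sec S U)))"

definition locally_nilpotent_on :: "nat \<Rightarrow> ('s, 'a) ringed_space \<Rightarrow> bool" where
  "locally_nilpotent_on p S \<longleftrightarrow>
     (\<forall>s \<in> topspace (sp S). \<exists>U. s \<in> U \<and> openin (sp S) U \<and>
        (\<exists>n::nat. add_pow (Sec S U) (p ^ n) \<one>\<^bsub>Sec S U\<^esub> = \<zero>\<^bsub>Sec S U\<^esub>))"

text \<open>A scheme over \<open>A\<close>, given by its structure map from \<open>A\<close> to the global sections.\<close>

definition scheme_over :: "('c, 'm) ring_scheme \<Rightarrow> ('s, 'a) ringed_space \<Rightarrow> ('c \<Rightarrow> 'a) \<Rightarrow> bool" where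
  "scheme_over A S \<beta> \<longleftrightarrow> is_scheme S \<and> \<beta> \<in> ring_hom A (global_sections S)"


section \<open>Finite locally free commutative group schemes\<close>

text \<open>A list of words of length \<open>m\<close> in an \<open>R\<close>-algebra \<open>A\<close> (with structure map \<open>\<eta>\<close>) represents the sum
  of the corresponding pure tensors in the \<open>m\<close>-fold tensor power of \<open>A\<close> over \<open>R\<close> (\<open>m \<ge> 2\<close>). The
  relation below is equality of the represented tensors.\<close>

inductive tensor_eq :: "'r ring \<Rightarrow> 'b ring \<Rightarrow> ('r \<Rightarrow> 'b) \<Rightarrow> 'b list list \<Rightarrow> 'b list list \<Rightarrow> bool"
  for R A \<eta> where
  refl: "tensor_eq R A \<eta> xs xs"
| sym: "tensor_eq R A \<eta> xs ys \<Longrightarrow> tensor_eq R A \<eta> ys xs"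
| trans: "tensor_eq R A \<eta> xs ys \<Longrightarrow> tensor_eq R A \<eta> ys zs \<Longrightarrow> tensor_eq R A \<eta> xs zs"
| comm: "tensor_eq R A \<eta> (xs @ ys) (ys @ xs)"
| cong: "tensor_eq R A \<eta> xs ys \<Longrightarrow> tensor_eq R A \<eta> (xs @ zs) (ys @ zs)"
| zero: "set (t @ u) \<subseteq> carrier A \<Longrightarrow> tensor_eq R A \<eta> [t @ [\<zero>\<^bsub>A\<^esub>] @ u] []"
| add: "set (t @ u) \<subseteq> carrier A \<Longrightarrow> x \<in> carrier A \<Longrightarrow> y \<in> carrier A \<Longrightarrow>
    tensor_eq R A \<eta> [t @ [x \<oplus>\<^bsub>A\<^esub> y] @ u] [t @ [x] @ u, t @ [y] @ u]"
| balance: "set (t @ u @ v) \<subseteq> carrier A \<Longrightarrow> x \<in> carrier A \<Longrightarrow> y \<in> carrier A \<Longrightarrow> r \<in> carrier R \<Longrightarrow>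
    tensor_eq R A \<eta> [t @ [\<eta> r \<otimes>\<^bsub>A\<^esub> x] @ u @ [y] @ v] [t @ [x] @ u @ [\<eta> r \<otimes>\<^bsub>A\<^esub> y] @ v]"

definition sum_in :: "'b ring \<Rightarrow> 'b list \<Rightarrow> 'b" where
  "sum_in A xs = foldr (\<lambda>x y. x \<oplus>\<^bsub>A\<^esub> y) xs \<zero>\<^bsub>A\<^esub>"

text \<open>A commutative Hopf algebra \<open>A\<close> over \<open>R\<close> that is also cocommutative. The value \<open>\<Delta> a\<close> is a
  representative of the comultiplication of \<open>a\<close>, as a list of pairs.\<close>

definition hopf_algebra ::
  "'r ring \<Rightarrow> 'b ring \<Rightarrow> ('r \<Rightarrow> 'b) \<Rightarrow> ('b \<Rightarrow> ('b \<times> 'b) list) \<Rightarrow> ('b \<Rightarrow> 'r) \<Rightarrow> ('b \<Rightarrow> 'b) \<Rightarrow> bool" where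
  "hopf_algebra R A \<eta> \<Delta> \<epsilon> anti \<longleftrightarrow>
     cring R \<and> cring A \<and> \<eta> \<in> ring_hom R A \<and> \<epsilon> \<in> ring_hom A R \<and> anti \<in> ring_hom A A \<and>
     (\<forall>r \<in> carrier R. \<epsilon> (\<eta> r) = r \<and> anti (\<eta> r) = \<eta> r \<and>
        tensor_eq R A \<eta> [[x, y]. (x, y) \<leftarrow> \<Delta> (\<eta> r)] [[\<eta> r, \<one>\<^bsub>A\<^esub>]]) \<and>
     (\<forall>a \<in> carrier A. set (\<Delta> a) \<subseteq> carrier A \<times> carrier A) \<and>
     (\<forall>a \<in> carrier A. \<forall>b \<in> carrier A.
        tensor_eq R A \<eta> [[x, y]. (x, y) \<leftarrow> \<Delta> (a \<oplus>\<^bsub>A\<^esub> b)] [[x, y]. (x, y) \<leftarrow> \<Delta> a @ \<Delta> b] \<and>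
        tensor_eq R A \<eta> [[x, y]. (x, y) \<leftarrow> \<Delta> (a \<otimes>\<^bsub>A\<^esub> b)]
          [[x \<otimes>\<^bsub>A\<^esub> x', y \<otimes>\<^bsub>A\<^esub> y']. (x, y) \<leftarrow> \<Delta> a, (x', y') \<leftarrow> \<Delta> b]) \<and>
     (\<forall>a \<in> carrier A.
        tensor_eq R A \<eta> [[x', x'', y]. (x, y) \<leftarrow> \<Delta> a, (x', x'') \<leftarrow> \<Delta> x]
                        [[x, y', y'']. (x, y) \<leftarrow> \<Delta> a, (y', y'') \<leftarrow> \<Delta> y] \<and>
        tensor_eq R A \<eta> [[x, y]. (x, y) \<leftarrow> \<Delta> a] [[y, x]. (x, y) \<leftarrow> \<Delta> a] \<and>
        sum_in A [\<eta> (\<epsilon> x) \<otimes>\<^bsub>A\<^esub> y. (x, y) \<leftarrow> \<Delta> a] = a \<and>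
        sum_in A [anti x \<otimes>\<^bsub>A\<^esub> y. (x, y) \<leftarrow> \<Delta> a] = \<eta> (\<epsilon> a))"

text \<open>A group scheme that is affine over the base, given by its sheaf of Hopf algebras. The
  comultiplication, counit and antipode are only used on affine opens, where the sections of the
  tensor product sheaf are the tensor product of the sections.\<close>

record ('s, 'a, 'b) group_scheme = "('s, 'b) presheaf" +
  unit_map :: "'s set \<Rightarrow> 'a \<Rightarrow> 'b"
  comult :: "'s set \<Rightarrow> 'b \<Rightarrow> ('b \<times> 'b) list"
  counit :: "'s set \<Rightarrow> 'b \<Rightarrow> 'a"
  antipode :: "'s set \<Rightarrow> 'b \<Rightarrow> 'b"

definition free_of_rank_on ::
  "('s, 'a) ringed_space \<Rightarrow> ('s, 'a, 'b) group_scheme \<Rightarrow> nat \<Rightarrow> 's set \<Rightarrow> bool" where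
  "free_of_rank_on S G r U \<longleftrightarrow>
     (\<exists>e \<in> {..<r} \<rightarrow> carrier (Sec G U). \<forall>V. openin (sp S) V \<and> V \<subseteq> U \<longrightarrow>
        (\<forall>a \<in> carrier (Sec G V). \<exists>!c. c \<in> {..<r} \<rightarrow>\<^sub>E carrier (Sec S V) \<and>
           a = (\<Oplus>\<^bsub>Sec G V\<^esub>i\<in>{..<r}. unit_map G V (c i) \<otimes>\<^bsub>Sec G V\<^esub> Res G U V (e i))))"

definition finite_flat_group_scheme ::
  "('s, 'a) ringed_space \<Rightarrow> ('s, 'a, 'b) group_scheme \<Rightarrow> bool" where
  "finite_flat_group_scheme S G \<longleftrightarrow>
     sheaf_of_rings (sp S) G \<and>
     (\<forall>U. openin (sp S) U \<longrightarrow> unit_map G U \<in> ring_hom (Sec S U) (Sec G U)) \<and>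
     (\<forall>U V. openin (sp S) U \<and> openin (sp S) V \<and> V \<subseteq> U \<longrightarrow>
        (\<forall>r \<in> carrier (Sec S U). Res G U V (unit_map G U r) = unit_map G V (Res S U V r))) \<and>
     (\<forall>s \<in> topspace (sp S). \<exists>r U. s \<in> U \<and> openin (sp S) U \<and> free_of_rank_on S G r U) \<and>
     (\<forall>U. affine_open S U \<longrightarrow>
        hopf_algebra (Sec S U) (Sec G U) (unit_map G U) (comult G U) (counit G U) (antipode G U)) \<and>
     (\<forall>U V. affine_open S U \<and> affine_open S V \<and> V \<subseteq> U \<longrightarrow>
        (\<forall>a \<in> carrier (Sec G U).
           tensor_eq (Sec S V) (Sec G V) (unit_map G V)
             [[Res G U V x, Res G U V y]. (x, y) \<leftarrow> comult G U a]
             [[x, y]. (x, y) \<leftarrow> comult G V (Res G U V a)] \<and>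
           counit G V (Res G U V a) = Res S U V (counit G U a) \<and>
           antipode G V (Res G U V a) = Res G U V (antipode G U a)))"

text \<open>Pullback maps over \<open>U\<close> of homomorphisms from the group scheme \<open>H\<close> to the group scheme \<open>G\<close>.\<close>

definition hopf_homs ::
  "('s, 'a) ringed_space \<Rightarrow> ('s, 'a, 'b) group_scheme \<Rightarrow> ('s, 'a, 'b) group_scheme \<Rightarrow> 's set \<Rightarrow>
   ('b \<Rightarrow> 'b) set" where
  "hopf_homs S G H U = {f \<in> ring_hom (Sec G U) (Sec H U).
     (\<forall>r \<in> carrier (Sec S U). f (unit_map G U r) = unit_map H U r) \<and>
     (\<forall>a \<in> carrier (Sec G U). counit H U (f a) = counit G U a \<and>
        tensor_eq (Sec S U) (Sec H U) (unit_map H U)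
          [[f x, f y]. (x, y) \<leftarrow> comult G U a] [[x, y]. (x, y) \<leftarrow> comult H U (f a)])}"

text \<open>The pullback of the sum of two homomorphisms with pullbacks \<open>f\<close> and \<open>g\<close>, and the pullback of
  multiplication by a natural number.\<close>

definition convolution ::
  "('s, 'a, 'b) group_scheme \<Rightarrow> 's set \<Rightarrow> ('b \<Rightarrow> 'b) \<Rightarrow> ('b \<Rightarrow> 'b) \<Rightarrow> 'b \<Rightarrow> 'b" where
  "convolution G U f g a = sum_in (Sec G U) [f x \<otimes>\<^bsub>Sec G U\<^esub> g y. (x, y) \<leftarrow> comult G U a]"

primrec mult_by :: "('s, 'a, 'b) group_scheme \<Rightarrow> 's set \<Rightarrow> nat \<Rightarrow> 'b \<Rightarrow> 'b" where
  "mult_by G U 0 = (\<lambda>a. unit_map G U (counit G U a))"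
| "mult_by G U (Suc m) = convolution G U (\<lambda>a. a) (mult_by G U m)"

definition augmentation_ideal ::
  "('s, 'a) ringed_space \<Rightarrow> ('s, 'a, 'b) group_scheme \<Rightarrow> 's set \<Rightarrow> 'b set" where
  "augmentation_ideal S G U = {a \<in> carrier (Sec G U). counit G U a = \<zero>\<^bsub>Sec S U\<^esub>}"


section \<open>Formal p-divisible groups and their Lie algebras\<close>

text \<open>\<open>level BT n\<close> is the \<open>p^n\<close>-torsion, and \<open>transition BT n\<close> is the pullback along the inclusion
  of \<open>level BT n\<close> into \<open>level BT (Suc n)\<close>.\<close>

record ('s, 'a, 'b) pdiv =
  level :: "nat \<Rightarrow> ('s, 'a, 'b) group_scheme"
  transition :: "nat \<Rightarrow> 's set \<Rightarrow> 'b \<Rightarrow> 'b"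

text \<open>The last condition says that \<open>level BT n\<close> is the kernel of \<open>p^n\<close> on \<open>level BT (Suc n)\<close>.
  The number \<open>h\<close> is the height at the point \<open>s\<close>.\<close>

definition p_divisible_group ::
  "nat \<Rightarrow> ('s, 'a) ringed_space \<Rightarrow> ('s, 'a, 'b) pdiv \<Rightarrow> bool" where
  "p_divisible_group p S BT \<longleftrightarrow>
     (\<forall>n. finite_flat_group_scheme S (level BT n)) \<and>
     (\<forall>s \<in> topspace (sp S). \<exists>h::nat. \<forall>n. \<exists>U. s \<in> U \<and> openin (sp S) U \<and>
        free_of_rank_on S (level BT n) (p ^ (n * h)) U) \<and>
     (\<forall>n U V. affine_open S U \<and> affine_open S V \<and> V \<subseteq> U \<longrightarrow>
        (\<forall>a \<in> carrier (Sec (level BT (Suc n)) U).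
           transition BT n V (Res (level BT (Suc n)) U V a)
             = Res (level BT n) U V (transition BT n U a))) \<and>
     (\<forall>n U. affine_open S U \<longrightarrow>
        transition BT n U \<in> hopf_homs S (level BT (Suc n)) (level BT n) U \<and>
        transition BT n U ` carrier (Sec (level BT (Suc n)) U) = carrier (Sec (level BT n) U) \<and>
        a_kernel (Sec (level BT (Suc n)) U) (Sec (level BT n) U) (transition BT n U)
          = genideal (Sec (level BT (Suc n)) U)
              (mult_by (level BT (Suc n)) U (p ^ n) ` augmentation_ideal S (level BT (Suc n)) U))"

text \<open>Formal: all torsion levels are infinitesimal thickenings of the zero section.\<close>

definition formal_p_divisible_group ::
  "nat \<Rightarrow> ('s, 'a) ringed_space \<Rightarrow> ('s, 'a, 'b) pdiv \<Rightarrow> bool" where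
  "formal_p_divisible_group p S BT \<longleftrightarrow> p_divisible_group p S BT \<and>
     (\<forall>n U. affine_open S U \<longrightarrow>
        (\<forall>a \<in> augmentation_ideal S (level BT n) U.
           \<exists>m::nat. a [^]\<^bsub>Sec (level BT n) U\<^esub> m = \<zero>\<^bsub>Sec (level BT n) U\<^esub>))"

text \<open>The ring of endomorphisms of \<open>BT\<close> over \<open>S\<close>. An endomorphism is given by its pullback maps, one
  for each level and each affine open; pulling back reverses the order of composition.\<close>

definition end_dom ::
  "('s, 'a) ringed_space \<Rightarrow> ('s, 'a, 'b) pdiv \<Rightarrow> (nat \<times> 's set \<times> 'b) set" where
  "end_dom S BT = {(n, U, a). affine_open S U \<and> a \<in> carrier (Sec (level BT n) U)}"

definition End ::
  "('s, 'a) ringed_space \<Rightarrow> ('s, 'a, 'b) pdiv \<Rightarrow> (nat \<times> 's set \<times> 'b \<Rightarrow> 'b) ring" where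
  "End S BT =
    \<lparr>carrier = {f \<in> extensional (end_dom S BT).
        (\<forall>n U. affine_open S U \<longrightarrow>
           (\<lambda>a. f (n, U, a)) \<in> hopf_homs S (level BT n) (level BT n) U) \<and>
        (\<forall>n U V. affine_open S U \<and> affine_open S V \<and> V \<subseteq> U \<longrightarrow>
           (\<forall>a \<in> carrier (Sec (level BT n) U).
              f (n, V, Res (level BT n) U V a) = Res (level BT n) U V (f (n, U, a)))) \<and>
        (\<forall>n U. affine_open S U \<longrightarrow>
           (\<forall>a \<in> carrier (Sec (level BT (Suc n)) U).
              f (n, U, transition BT n U a) = transition BT n U (f (Suc n, U, a))))},
     monoid.mult = (\<lambda>f g. \<lambda>(n, U, a) \<in> end_dom S BT. g (n, U, f (n, U, a))),
     one = (\<lambda>(n, U, a) \<in> end_dom S BT. a),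
     ring.zero = (\<lambda>(n, U, a) \<in> end_dom S BT. unit_map (level BT n) U (counit (level BT n) U a)),
     add = (\<lambda>f g. \<lambda>(n, U, a) \<in> end_dom S BT.
        convolution (level BT n) U (\<lambda>x. f (n, U, x)) (\<lambda>y. g (n, U, y)) a)\<rparr>"

text \<open>Functions on \<open>BT\<close> over \<open>U\<close>, i.e. the inverse limit of the rings of functions of the levels.\<close>

definition formal_functions :: "('s, 'a, 'b) pdiv \<Rightarrow> 's set \<Rightarrow> (nat \<Rightarrow> 'b) set" where
  "formal_functions BT U = {a. \<forall>n. a n \<in> carrier (Sec (level BT n) U) \<and>
     transition BT n U (a (Suc n)) = a n}"

text \<open>The Lie algebra of a group scheme over an affine open \<open>U\<close>: derivations along the zero
  section.\<close>

definition point_derivations ::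
  "('s, 'a) ringed_space \<Rightarrow> ('s, 'a, 'b) group_scheme \<Rightarrow> 's set \<Rightarrow> ('b \<Rightarrow> 'a) set" where
  "point_derivations S G U = {\<delta> \<in> carrier (Sec G U) \<rightarrow> carrier (Sec S U).
     (\<forall>a \<in> carrier (Sec G U). \<forall>b \<in> carrier (Sec G U).
        \<delta> (a \<oplus>\<^bsub>Sec G U\<^esub> b) = \<delta> a \<oplus>\<^bsub>Sec S U\<^esub> \<delta> b \<and>
        \<delta> (a \<otimes>\<^bsub>Sec G U\<^esub> b) =
          counit G U a \<otimes>\<^bsub>Sec S U\<^esub> \<delta> b \<oplus>\<^bsub>Sec S U\<^esub> counit G U b \<otimes>\<^bsub>Sec S U\<^esub> \<delta> a) \<and>
     (\<forall>r \<in> carrier (Sec S U). \<forall>a \<in> carrier (Sec G U).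
        \<delta> (unit_map G U r \<otimes>\<^bsub>Sec G U\<^esub> a) = r \<otimes>\<^bsub>Sec S U\<^esub> \<delta> a)}"

text \<open>The sheaf \<open>Lie(BT)\<close>, the colimit over \<open>n\<close> of the sheaves \<open>Lie(level BT n)\<close>. A section over an
  open \<open>U\<close> is a compatible family, indexed by the affine opens \<open>V \<subseteq> U\<close>, of derivations of the
  formal functions over \<open>V\<close> each of which factors through some level. (Over affine opens the formal
  functions surject onto each level, and sections commute with the filtered colimit.)\<close>

definition lie_dom ::
  "('s, 'a) ringed_space \<Rightarrow> ('s, 'a, 'b) pdiv \<Rightarrow> 's set \<Rightarrow> ('s set \<times> (nat \<Rightarrow> 'b)) set" where
  "lie_dom S BT U = {(V, a). affine_open S V \<and> V \<subseteq> U \<and> a \<in> formal_functions BT V}"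

definition Lie ::
  "('s, 'a) ringed_space \<Rightarrow> ('s, 'a, 'b) pdiv \<Rightarrow> 's set \<Rightarrow> ('s set \<times> (nat \<Rightarrow> 'b) \<Rightarrow> 'a) set" where
  "Lie S BT U = {D \<in> extensional (lie_dom S BT U).
     (\<forall>V. affine_open S V \<and> V \<subseteq> U \<longrightarrow>
        (\<exists>n. \<exists>\<delta> \<in> point_derivations S (level BT n) V.
           \<forall>a \<in> formal_functions BT V. D (V, a) = \<delta> (a n))) \<and>
     (\<forall>V W. affine_open S V \<and> affine_open S W \<and> W \<subseteq> V \<and> V \<subseteq> U \<longrightarrow>
        (\<forall>a \<in> formal_functions BT V.
           D (W, \<lambda>n. Res (level BT n) V W (a n)) = Res S V W (D (V, a))))}"

definition lie_zero ::
  "('s, 'a) ringed_space \<Rightarrow> ('s, 'a, 'b) pdiv \<Rightarrow> 's set \<Rightarrow> 's set \<times> (nat \<Rightarrow> 'b) \<Rightarrow> 'a" where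
  "lie_zero S BT U = (\<lambda>(V, a) \<in> lie_dom S BT U. \<zero>\<^bsub>Sec S V\<^esub>)"

definition lie_smult ::
  "('s, 'a) ringed_space \<Rightarrow> ('s, 'a, 'b) pdiv \<Rightarrow> 's set \<Rightarrow> 'a \<Rightarrow>
   ('s set \<times> (nat \<Rightarrow> 'b) \<Rightarrow> 'a) \<Rightarrow> 's set \<times> (nat \<Rightarrow> 'b) \<Rightarrow> 'a" where
  "lie_smult S BT U c D = (\<lambda>(V, a) \<in> lie_dom S BT U. Res S U V c \<otimes>\<^bsub>Sec S V\<^esub> D (V, a))"

text \<open>The map on \<open>Lie(BT)\<close> induced by an endomorphism (with pullback maps \<open>f\<close>).\<close>

definition lie_map ::
  "('s, 'a) ringed_space \<Rightarrow> ('s, 'a, 'b) pdiv \<Rightarrow> 's set \<Rightarrow> (nat \<times> 's set \<times> 'b \<Rightarrow> 'b) \<Rightarrow>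
   ('s set \<times> (nat \<Rightarrow> 'b) \<Rightarrow> 'a) \<Rightarrow> 's set \<times> (nat \<Rightarrow> 'b) \<Rightarrow> 'a" where
  "lie_map S BT U f D = (\<lambda>(V, a) \<in> lie_dom S BT U. D (V, \<lambda>n. f (n, V, a n)))"

text \<open>A subsheaf \<open>L\<close> of \<open>Lie(BT)\<close> is invertible if it locally is freely generated by one
  section.\<close>

definition invertible_subsheaf ::
  "('s, 'a) ringed_space \<Rightarrow> ('s, 'a, 'b) pdiv \<Rightarrow>
   ('s set \<Rightarrow> ('s set \<times> (nat \<Rightarrow> 'b) \<Rightarrow> 'a) set) \<Rightarrow> bool" where
  "invertible_subsheaf S BT L \<longleftrightarrow>
     (\<forall>s \<in> topspace (sp S). \<exists>U. s \<in> U \<and> openin (sp S) U \<and>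
        (\<exists>D\<^sub>0 \<in> L U. \<forall>V. openin (sp S) V \<and> V \<subseteq> U \<longrightarrow>
           (\<forall>c \<in> carrier (Sec S V).
              lie_smult S BT V c (restrict D\<^sub>0 (lie_dom S BT V)) \<in> L V) \<and>
           (\<forall>D \<in> L V. \<exists>!c. c \<in> carrier (Sec S V) \<and>
              D = lie_smult S BT V c (restrict D\<^sub>0 (lie_dom S BT V)))))"


section \<open>Special formal modules\<close>

text \<open>The action of an element of \<open>O_breve\<close> on \<open>Lie(BT)\<close> over \<open>U\<close> through the structure map \<open>\<beta>\<close> of \<open>S\<close>.\<close>

definition base_smult ::
  "('s, 'a) ringed_space \<Rightarrow> ('c \<Rightarrow> 'a) \<Rightarrow> ('s, 'a, 'b) pdiv \<Rightarrow> 's set \<Rightarrow> 'c \<Rightarrow>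
   ('s set \<times> (nat \<Rightarrow> 'b) \<Rightarrow> 'a) \<Rightarrow> 's set \<times> (nat \<Rightarrow> 'b) \<Rightarrow> 'a" where
  "base_smult S \<beta> BT U x D = lie_smult S BT U (Res S (topspace (sp S)) U (\<beta> x)) D"

context drinfeld_data
begin

definition Lie_part ::
  "('s, 'a) ringed_space \<Rightarrow> ((nat \<Rightarrow> 'm set) \<Rightarrow> 'a) \<Rightarrow> ('s, 'a, 'b) pdiv \<Rightarrow>
   ('e \<Rightarrow> nat \<times> 's set \<times> 'b \<Rightarrow> 'b) \<Rightarrow> nat \<Rightarrow> 's set \<Rightarrow> ('s set \<times> (nat \<Rightarrow> 'b) \<Rightarrow> 'a) set" where
  "Lie_part S \<beta> BT \<iota> i U = {D \<in> Lie S BT U. \<forall>a \<in> carrier (integers p M z Ed).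
     lie_map S BT U (\<iota> (j a)) D = base_smult S \<beta> BT U (\<psi> ((\<sigma> ^^ i) a)) D}"

definition special_formal_module ::
  "('s, 'a) ringed_space \<Rightarrow> ((nat \<Rightarrow> 'm set) \<Rightarrow> 'a) \<Rightarrow> ('s, 'a, 'b) pdiv \<Rightarrow>
   ('e \<Rightarrow> nat \<times> 's set \<times> 'b \<Rightarrow> 'b) \<Rightarrow> bool" where
  "special_formal_module S \<beta> BT \<iota> \<longleftrightarrow>
     scheme_over (O_breve p M z E w) S \<beta> \<and> locally_nilpotent_on p S \<and>
     formal_p_divisible_group p S BT \<and>
     \<iota> \<in> ring_hom OD (End S BT) \<and>
     (\<forall>U. openin (sp S) U \<longrightarrow> (\<forall>D \<in> Lie S BT U. \<forall>r \<in> carrier (integers p M z E).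
        lie_map S BT U (\<iota> (j r)) D = base_smult S \<beta> BT U (\<psi> r) D)) \<and>
     (\<forall>i<d. invertible_subsheaf S BT (Lie_part S \<beta> BT \<iota> i))"

text \<open>The target of \<open>\<Pi>\<^sub>i\<close> plays no role for its vanishing: \<open>\<Pi>\<^sub>i\<close> is the map induced by \<open>v\<close> on
  the \<open>i\<close>-th part.\<close>

definition critical_index ::
  "('s, 'a) ringed_space \<Rightarrow> ((nat \<Rightarrow> 'm set) \<Rightarrow> 'a) \<Rightarrow> ('s, 'a, 'b) pdiv \<Rightarrow>
   ('e \<Rightarrow> nat \<times> 's set \<times> 'b \<Rightarrow> 'b) \<Rightarrow> nat \<Rightarrow> bool" where
  "critical_index S \<beta> BT \<iota> i \<longleftrightarrow>
     (\<forall>U. openin (sp S) U \<longrightarrow> (\<forall>D \<in> Lie_part S \<beta> BT \<iota> i U.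
        lie_map S BT U (\<iota> v) D = lie_zero S BT U))"

end

end

theory Submission
  imports Defs
begin

text \<open>The ring of functions on an affine open of an irreducible perfect scheme is reduced with
  irreducible spectrum, hence has no zero divisors. Since \<open>\<varpi>\<close> vanishes in the residue field,
  \<open>\<Pi>\<^sup>d = \<varpi>\<close> kills the Lie algebra. Over a small affine open, choose generators \<open>D\<^sub>i\<close> of the parts
  and write \<open>\<Pi> D\<^sub>i = c\<^sub>i D\<^sub>i\<^sub>-\<^sub>1\<close> for \<open>0 < i < d\<close>. Then \<open>0 = \<Pi>\<^sup>d D\<^sub>d\<^sub>-\<^sub>1 = c\<^sub>d\<^sub>-\<^sub>1 \<dots> c\<^sub>1 \<Pi> D\<^sub>0\<close>, so some
  \<open>c\<^sub>i\<close> or \<open>\<Pi> D\<^sub>0\<close> vanishes there. As restriction to nonempty opens is injective, the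
  corresponding \<open>\<Pi>\<^sub>i\<close> vanishes everywhere.\<close>

section \<open>Sections of irreducible perfect schemes\<close>

text \<open>The generating sets D(f) already form a basis, because D(f) \<inter> D(g) = D(fg) when
  the points are prime ideals. The induction follows the generation of \<open>Y\<close> and keeps
  the point arbitrary.\<close>

lemma spec_topology_basis:
  assumes R: "cring R" and "openin (spec_topology R) Y" "P \<in> Y"
  shows "\<exists>f\<in>carrier R. f \<notin> P \<and> {Q. primeideal Q R \<and> f \<notin> Q} \<subseteq> Y"
proof -
  interpret cring R by (fact R)
  have "generate_topology_on {{P. primeideal P R \<and> f \<notin> P} | f. f \<in> carrier R} Y"
    using assms(2) unfolding spec_topology_def openin_topology_generated_by_iff .
  then have "\<forall>P. primeideal P R \<longrightarrow> P \<in> Y \<longrightarrow>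
    (\<exists>f\<in>carrier R. f \<notin> P \<and> {Q. primeideal Q R \<and> f \<notin> Q} \<subseteq> Y)"
  proof induction
    case (Int a b)
    show ?case
    proof (intro allI impI)
      fix P assume P: "primeideal P R" "P \<in> a \<inter> b"
      then obtain f g where f: "f \<in> carrier R" "f \<notin> P" "{Q. primeideal Q R \<and> f \<notin> Q} \<subseteq> a"
        and g: "g \<in> carrier R" "g \<notin> P" "{Q. primeideal Q R \<and> g \<notin> Q} \<subseteq> b"
        using Int.IH by blast
      have "f \<otimes>\<^bsub>R\<^esub> g \<notin> P"
        using primeideal.I_prime[OF P(1)] f g by blast
      moreover have "f \<notin> Q \<and> g \<notin> Q" if "primeideal Q R" "f \<otimes>\<^bsub>R\<^esub> g \<notin> Q" for Q
      proof -
        interpret Q: primeideal Q R by (fact that(1))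
        show ?thesis using that(2) f(1) g(1) Q.I_l_closed Q.I_r_closed by blast
      qed
      ultimately show "\<exists>f\<in>carrier R. f \<notin> P \<and> {Q. primeideal Q R \<and> f \<notin> Q} \<subseteq> a \<inter> b"
        using f g by (intro bexI[of _ "f \<otimes>\<^bsub>R\<^esub> g"]) auto
    qed
  next
    case (UN K)
    show ?case
    proof (intro allI impI)
      fix P assume P: "primeideal P R" "P \<in> \<Union>K"
      then obtain k where "k \<in> K" "P \<in> k" by blast
      then obtain f where "f \<in> carrier R" "f \<notin> P" "{Q. primeideal Q R \<and> f \<notin> Q} \<subseteq> k"
        using UN.IH P(1) by blast
      then show "\<exists>f\<in>carrier R. f \<notin> P \<and> {Q. primeideal Q R \<and> f \<notin> Q} \<subseteq> \<Union>K"
        using \<open>k \<in> K\<close> by blast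
    qed
  qed auto
  moreover have "primeideal P R"
  proof -
    have "P \<in> topspace (spec_topology R)"
      using assms(2,3) openin_subset by blast
    then show ?thesis
      by (auto simp: spec_topology_def topology_generated_by_topspace)
  qed
  ultimately show ?thesis using assms(3) by blast
qed

section \<open>Restriction maps and distinguished opens of affine opens\<close>

locale ringed_scheme =
  fixes S :: "('s, 'a) ringed_space"
  assumes scheme: "is_scheme S"
begin

lemma sheaf: "sheaf_of_rings (sp S) S"
  using scheme by (simp add: is_scheme_def)

lemma sections_cring: "openin (sp S) U \<Longrightarrow> cring (Sec S U)"
  using sheaf by (simp add: sheaf_of_rings_def presheaf_of_rings_def)

lemma res_hom:
  "openin (sp S) U \<Longrightarrow> openin (sp S) V \<Longrightarrow> V \<subseteq> U \<Longrightarrow> Res S U V \<in> ring_hom (Sec S U) (Sec S V)"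
  using sheaf by (simp add: sheaf_of_rings_def presheaf_of_rings_def)

lemma res_ring_hom_cring:
  assumes "openin (sp S) U" "openin (sp S) V" "V \<subseteq> U"
  shows "ring_hom_cring (Sec S U) (Sec S V) (Res S U V)"
  using sections_cring[OF assms(1)] sections_cring[OF assms(2)] res_hom[OF assms]
  by (simp add: ring_hom_cring_def ring_hom_cring_axioms_def)

lemma res_res:
  "openin (sp S) U \<Longrightarrow> openin (sp S) V \<Longrightarrow> openin (sp S) W \<Longrightarrow> W \<subseteq> V \<Longrightarrow> V \<subseteq> U \<Longrightarrow>
    x \<in> carrier (Sec S U) \<Longrightarrow> Res S V W (Res S U V x) = Res S U W x"
  using sheaf by (simp add: sheaf_of_rings_def presheaf_of_rings_def)

text \<open>The sheaf axiom for the empty cover makes the ring over the empty set trivial; the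
  family to be glued is void, so \<open>undefined\<close> can stand for it.\<close>

lemma sections_empty:
  assumes "x \<in> carrier (Sec S {})" "y \<in> carrier (Sec S {})"
  shows "x = y"
proof -
  have "\<exists>!y. y \<in> carrier (Sec S (\<Union>{})) \<and> (\<forall>V\<in>{}. Res S (\<Union>{}) V y = undefined V)"
    using sheaf unfolding sheaf_of_rings_def by (elim conjE allE[of _ "{}"]) blast
  then show ?thesis using assms by auto
qed

lemma affine_openin: "affine_open S U \<Longrightarrow> openin (sp S) U"
  by (simp add: affine_open_def)

text \<open>\<open>B f\<close> is D(f) carried over to \<open>A\<close>. The predicate keeps what
  later arguments take from the homeomorphism with the spectrum: localizations as sections, D(fg) =
  D(f) \<inter> D(g), D(0) empty, and the basis property.\<close>

definition basic_opens :: "'s set \<Rightarrow> ('a \<Rightarrow> 's set) \<Rightarrow> bool" where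
  "basic_opens A B \<longleftrightarrow>
     (\<forall>f\<in>carrier (Sec S A). openin (sp S) (B f) \<and> B f \<subseteq> A \<and>
        is_localization (Sec S A) f (Sec S (B f)) (Res S A (B f))) \<and>
     (\<forall>f\<in>carrier (Sec S A). \<forall>g\<in>carrier (Sec S A). B (f \<otimes>\<^bsub>Sec S A\<^esub> g) = B f \<inter> B g) \<and>
     B \<zero>\<^bsub>Sec S A\<^esub> = {} \<and>
     (\<forall>Y s. openin (sp S) Y \<and> Y \<subseteq> A \<and> s \<in> Y \<longrightarrow>
        (\<exists>f\<in>carrier (Sec S A). s \<in> B f \<and> B f \<subseteq> Y))"

text \<open>D(f) is pulled back along the chart \<open>\<phi>\<close>. Continuity makes it open, and
  primality of \<open>\<phi> s\<close> gives the rules for products and for 0; the basis property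
  uses that \<open>\<phi>\<close> is open and injective.\<close>

lemma affine_basic_opens:
  assumes "affine_open S A"
  shows "\<exists>B. basic_opens A B"
proof -
  let ?R = "Sec S A"
  have A: "openin (sp S) A" using assms by (rule affine_openin)
  interpret cring ?R using A by (rule sections_cring)
  obtain \<phi> where hom: "homeomorphic_map (subtopology (sp S) A) (spec_topology ?R) \<phi>"
    and loc: "\<forall>f \<in> carrier ?R. is_localization ?R f (Sec S {s \<in> A. f \<notin> \<phi> s})
                (Res S A {s \<in> A. f \<notin> \<phi> s})"
    using assms by (auto simp: affine_open_def)
  define B where "B f = {s \<in> A. f \<notin> \<phi> s}" for f
  have top: "topspace (subtopology (sp S) A) = A"
    using openin_subset[OF A] by auto
  have surj: "\<phi> ` A = topspace (spec_topology ?R)"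
    using homeomorphic_imp_surjective_map[OF hom] top by simp
  have prime: "primeideal (\<phi> s) ?R" if "s \<in> A" for s
  proof -
    have "\<phi> s \<in> topspace (spec_topology ?R)" using surj that by blast
    then show ?thesis by (auto simp: spec_topology_def topology_generated_by_topspace)
  qed
  have cont: "continuous_map (subtopology (sp S) A) (spec_topology ?R) \<phi>"
    using hom homeomorphic_imp_continuous_map by blast
  have B_open: "openin (sp S) (B f)" if f: "f \<in> carrier ?R" for f
  proof -
    have "openin (spec_topology ?R) {P. primeideal P ?R \<and> f \<notin> P}"
      unfolding spec_topology_def using f by (intro topology_generated_by_Basis) blast
    from openin_continuous_map_preimage[OF cont this]
    have "openin (subtopology (sp S) A) {s \<in> A. \<phi> s \<in> {P. primeideal P ?R \<and> f \<notin> P}}"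
      by (simp only: top)
    moreover have "{s \<in> A. \<phi> s \<in> {P. primeideal P ?R \<and> f \<notin> P}} = B f"
      using prime by (auto simp: B_def)
    ultimately show ?thesis using A openin_trans_full by fastforce
  qed
  have "openin (sp S) (B f) \<and> B f \<subseteq> A \<and> is_localization ?R f (Sec S (B f)) (Res S A (B f))"
    if "f \<in> carrier ?R" for f
    using that B_open loc by (auto simp: B_def)
  moreover have "B (f \<otimes>\<^bsub>?R\<^esub> g) = B f \<inter> B g" if fg: "f \<in> carrier ?R" "g \<in> carrier ?R" for f g
  proof -
    have "f \<otimes>\<^bsub>?R\<^esub> g \<in> \<phi> s \<longleftrightarrow> f \<in> \<phi> s \<or> g \<in> \<phi> s" if "s \<in> A" for s
    proof -
      interpret P: primeideal "\<phi> s" ?R using that by (rule prime)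
      show ?thesis using fg P.I_prime P.I_l_closed P.I_r_closed by blast
    qed
    then show ?thesis by (auto simp: B_def)
  qed
  moreover have "B \<zero>\<^bsub>?R\<^esub> = {}"
  proof -
    have "\<zero>\<^bsub>?R\<^esub> \<in> \<phi> s" if "s \<in> A" for s
    proof -
      interpret P: primeideal "\<phi> s" ?R using that by (rule prime)
      show ?thesis by simp
    qed
    then show ?thesis by (auto simp: B_def)
  qed
  moreover have "\<exists>f\<in>carrier ?R. s \<in> B f \<and> B f \<subseteq> Y"
    if Y: "openin (sp S) Y" "Y \<subseteq> A" "s \<in> Y" for Y s
  proof -
    have "openin (subtopology (sp S) A) Y"
      using Y by (simp add: openin_open_subtopology[OF A])
    then have "openin (spec_topology ?R) (\<phi> ` Y)"
      using homeomorphic_imp_open_map[OF hom] by (simp add: open_map_def)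
    then obtain f where f: "f \<in> carrier ?R" "f \<notin> \<phi> s"
      "{Q. primeideal Q ?R \<and> f \<notin> Q} \<subseteq> \<phi> ` Y"
      using spec_topology_basis[OF is_cring, of "\<phi> ` Y" "\<phi> s"] Y(3) by blast
    have inj: "inj_on \<phi> A"
      using homeomorphic_imp_injective_map[OF hom] top by simp
    have "B f \<subseteq> Y"
    proof
      fix t assume "t \<in> B f"
      then have t: "t \<in> A" "f \<notin> \<phi> t" by (auto simp: B_def)
      then obtain u where "u \<in> Y" "\<phi> t = \<phi> u" using f(3) prime by blast
      then show "t \<in> Y" using inj t(1) Y(2) by (metis inj_onD subsetD)
    qed
    then show "\<exists>f\<in>carrier ?R. s \<in> B f \<and> B f \<subseteq> Y"
      using f Y by (auto simp: B_def)
  qed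
  ultimately have "basic_opens A B" by (simp add: basic_opens_def)
  then show ?thesis by blast
qed

text \<open>If 1 = 0 over \<open>U\<close>, this persists on some D(f) inside \<open>U\<close>
  around a point \<open>s\<close>; the localization then forces a power of \<open>f\<close> to
  vanish, although \<open>s\<close> lies in D of every power of \<open>f\<close>.\<close>

lemma sections_nontrivial:
  assumes U: "openin (sp S) U" "U \<noteq> {}"
  shows "\<one>\<^bsub>Sec S U\<^esub> \<noteq> \<zero>\<^bsub>Sec S U\<^esub>"
proof
  assume eq: "\<one>\<^bsub>Sec S U\<^esub> = \<zero>\<^bsub>Sec S U\<^esub>"
  obtain s where s: "s \<in> U" using U by blast
  then have "s \<in> topspace (sp S)" using U(1) openin_subset by blast
  then obtain A where A: "s \<in> A" "affine_open S A"
    using scheme by (auto simp: is_scheme_def)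
  have oA: "openin (sp S) A" using A affine_openin by blast
  interpret A: cring "Sec S A" using oA by (rule sections_cring)
  obtain B where B: "basic_opens A B"
    using affine_basic_opens[OF A(2)] by blast
  have B1: "\<And>f. f \<in> carrier (Sec S A) \<Longrightarrow> openin (sp S) (B f) \<and> B f \<subseteq> A \<and>
      is_localization (Sec S A) f (Sec S (B f)) (Res S A (B f))"
    and B2: "\<And>f g. f \<in> carrier (Sec S A) \<Longrightarrow> g \<in> carrier (Sec S A) \<Longrightarrow>
      B (f \<otimes>\<^bsub>Sec S A\<^esub> g) = B f \<inter> B g"
    and B3: "B \<zero>\<^bsub>Sec S A\<^esub> = {}"
    and B4: "\<And>Y s. openin (sp S) Y \<Longrightarrow> Y \<subseteq> A \<Longrightarrow> s \<in> Y \<Longrightarrow>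
      \<exists>f\<in>carrier (Sec S A). s \<in> B f \<and> B f \<subseteq> Y"
    using B by (simp_all add: basic_opens_def)
  obtain f where f: "f \<in> carrier (Sec S A)" "s \<in> B f" "B f \<subseteq> U \<inter> A"
    using B4[of "U \<inter> A" s] U oA s A(1) by blast
  have oB: "openin (sp S) (B f)" using B1 f by blast
  interpret UB: ring_hom_cring "Sec S U" "Sec S (B f)" "Res S U (B f)"
    using U oB f by (intro res_ring_hom_cring) auto
  interpret AB: ring_hom_cring "Sec S A" "Sec S (B f)" "Res S A (B f)"
    using oA oB f by (intro res_ring_hom_cring) auto
  have "\<one>\<^bsub>Sec S (B f)\<^esub> = \<zero>\<^bsub>Sec S (B f)\<^esub>"
    using eq UB.hom_one UB.hom_zero by simp
  then have "Res S A (B f) \<one>\<^bsub>Sec S A\<^esub> = \<zero>\<^bsub>Sec S (B f)\<^esub>" by simp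
  then obtain n :: nat where n: "f [^]\<^bsub>Sec S A\<^esub> n \<otimes>\<^bsub>Sec S A\<^esub> \<one>\<^bsub>Sec S A\<^esub> = \<zero>\<^bsub>Sec S A\<^esub>"
    using B1[OF f(1)] unfolding is_localization_def by blast
  have "s \<in> B (f [^]\<^bsub>Sec S A\<^esub> m)" for m :: nat
  proof (induction m)
    case 0
    \<comment> \<open>\<open>basic_opens\<close> does not state the value of \<open>B\<close> at 1;
      the product rule for f times 1 still puts \<open>s\<close> into it.\<close>
    have "B f = B f \<inter> B \<one>\<^bsub>Sec S A\<^esub>" using B2[of f "\<one>\<^bsub>Sec S A\<^esub>"] f by simp
    then show ?case using f by auto
  next
    case (Suc m)
    then show ?case using B2[of "f [^]\<^bsub>Sec S A\<^esub> m" f] f by simp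
  qed
  then show False using n B3 f(1) by (metis A.nat_pow_closed A.r_one empty_iff)
qed

end

section \<open>Reducedness and integrality over irreducible perfect schemes\<close>

locale integral_scheme = ringed_scheme +
  fixes p :: nat
  assumes irreducible: "irreducible_space (sp S)"
    and perfect: "perfect_scheme p S"
    and prime: "Factorial_Ring.prime p"
begin

lemma open_Int_nonempty:
  assumes "openin (sp S) U" "openin (sp S) V" "U \<noteq> {}" "V \<noteq> {}"
  shows "U \<inter> V \<noteq> {}"
proof
  assume "U \<inter> V = {}"
  moreover have "U \<subseteq> topspace (sp S)" "V \<subseteq> topspace (sp S)"
    using assms openin_subset by blast+
  ultimately have "(topspace (sp S) - U) \<union> (topspace (sp S) - V) = topspace (sp S)" by blast
  then have "topspace (sp S) - U = topspace (sp S) \<or> topspace (sp S) - V = topspace (sp S)"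
    using irreducible assms unfolding irreducible_space_def by (metis openin_closedin_eq)
  then show False using assms \<open>U \<subseteq> _\<close> \<open>V \<subseteq> _\<close> by blast
qed

text \<open>Frobenius is injective on the sections of a perfect scheme, so a vanishing power with
  exponent \<open>p ^ m\<close> can be undone one factor \<open>p\<close> at a time;
  \<open>n \<le> p ^ n\<close> brings any exponent to this shape.\<close>

lemma sections_reduced:
  assumes U: "openin (sp S) U" and x: "x \<in> carrier (Sec S U)"
    and n: "x [^]\<^bsub>Sec S U\<^esub> (n::nat) = \<zero>\<^bsub>Sec S U\<^esub>"
  shows "x = \<zero>\<^bsub>Sec S U\<^esub>"
proof -
  interpret cring "Sec S U" using U by (rule sections_cring)
  have p: "2 \<le> p" using prime by (rule prime_ge_2_nat)
  have inj: "inj_on (\<lambda>x. x [^]\<^bsub>Sec S U\<^esub> p) (carrier (Sec S U))"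
    using perfect U by (auto simp: perfect_scheme_def bij_betw_def)
  have "x [^]\<^bsub>Sec S U\<^esub> (p ^ m) = \<zero>\<^bsub>Sec S U\<^esub> \<Longrightarrow> x = \<zero>\<^bsub>Sec S U\<^esub>" for m :: nat
  proof (induction m)
    case 0
    then show ?case using x by simp
  next
    case (Suc m)
    have "(x [^]\<^bsub>Sec S U\<^esub> (p ^ m)) [^]\<^bsub>Sec S U\<^esub> p = \<zero>\<^bsub>Sec S U\<^esub> [^]\<^bsub>Sec S U\<^esub> p"
      using Suc.prems x p by (simp add: nat_pow_pow nat_pow_zero mult.commute)
    then have "x [^]\<^bsub>Sec S U\<^esub> (p ^ m) = \<zero>\<^bsub>Sec S U\<^esub>"
      using inj_onD[OF inj] x by simp
    then show ?case by (rule Suc.IH)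
  qed
  moreover have "x [^]\<^bsub>Sec S U\<^esub> (p ^ n) = \<zero>\<^bsub>Sec S U\<^esub>"
  proof -
    have "n \<le> p ^ n" using power_gt_expt[of p n] p by simp
    then obtain l where "p ^ n = n + l" using le_iff_add by blast
    then show ?thesis using n x by (simp add: nat_pow_mult[symmetric])
  qed
  ultimately show ?thesis by blast
qed

text \<open>D(x) and D(y) are disjoint when xy = 0, so irreducibility empties one of them; an empty
  D(f) means that \<open>f\<close> is nilpotent, hence 0 by reducedness.\<close>

lemma affine_sections_integral:
  assumes A: "affine_open S A" and x: "x \<in> carrier (Sec S A)" and y: "y \<in> carrier (Sec S A)"
    and xy: "x \<otimes>\<^bsub>Sec S A\<^esub> y = \<zero>\<^bsub>Sec S A\<^esub>"
  shows "x = \<zero>\<^bsub>Sec S A\<^esub> \<or> y = \<zero>\<^bsub>Sec S A\<^esub>"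
proof -
  have oA: "openin (sp S) A" using A affine_openin by blast
  interpret A: cring "Sec S A" using oA by (rule sections_cring)
  obtain B where B: "basic_opens A B"
    using affine_basic_opens[OF A] by blast
  have B1: "\<And>f. f \<in> carrier (Sec S A) \<Longrightarrow> openin (sp S) (B f) \<and> B f \<subseteq> A \<and>
      is_localization (Sec S A) f (Sec S (B f)) (Res S A (B f))"
    and B2: "\<And>f g. f \<in> carrier (Sec S A) \<Longrightarrow> g \<in> carrier (Sec S A) \<Longrightarrow>
      B (f \<otimes>\<^bsub>Sec S A\<^esub> g) = B f \<inter> B g"
    and B3: "B \<zero>\<^bsub>Sec S A\<^esub> = {}"
    using B by (simp_all add: basic_opens_def)
  have zero: "f = \<zero>\<^bsub>Sec S A\<^esub>" if f: "f \<in> carrier (Sec S A)" "B f = {}" for f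
  proof -
    interpret AB: ring_hom_cring "Sec S A" "Sec S {}" "Res S A {}"
      using oA by (intro res_ring_hom_cring) auto
    \<comment> \<open>Here the localization at \<open>f\<close> is the trivial ring over the empty
      set, so 1 lies in the kernel of the localization map.\<close>
    have "Res S A {} \<one>\<^bsub>Sec S A\<^esub> = \<zero>\<^bsub>Sec S {}\<^esub>"
      by (intro sections_empty) auto
    then obtain n :: nat where "f [^]\<^bsub>Sec S A\<^esub> n \<otimes>\<^bsub>Sec S A\<^esub> \<one>\<^bsub>Sec S A\<^esub> = \<zero>\<^bsub>Sec S A\<^esub>"
      using B1[OF f(1)] A.one_closed unfolding is_localization_def f(2) by blast
    then show ?thesis using sections_reduced[OF oA f(1), of n] f(1) by simp
  qed
  have "B x \<inter> B y = {}" using B2[OF x y] xy B3 by simp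
  then have "B x = {} \<or> B y = {}" using open_Int_nonempty B1 x y by blast
  then show ?thesis using zero x y by blast
qed

text \<open>Shrink \<open>W\<close> to a nonempty D(f): vanishing there means that some power of
  \<open>f\<close> kills \<open>x\<close>. In a domain a nonzero \<open>x\<close> would force f = 0
  and hence D(f) empty.\<close>

lemma affine_res_eq_zero:
  assumes A: "affine_open S A" and x: "x \<in> carrier (Sec S A)"
    and W: "openin (sp S) W" "W \<subseteq> A" "W \<noteq> {}" and xW: "Res S A W x = \<zero>\<^bsub>Sec S W\<^esub>"
  shows "x = \<zero>\<^bsub>Sec S A\<^esub>"
proof (rule ccontr)
  assume x0: "x \<noteq> \<zero>\<^bsub>Sec S A\<^esub>"
  have oA: "openin (sp S) A" using A affine_openin by blast
  interpret A: cring "Sec S A" using oA by (rule sections_cring)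
  obtain B where B: "basic_opens A B"
    using affine_basic_opens[OF A] by blast
  have B1: "\<And>f. f \<in> carrier (Sec S A) \<Longrightarrow> openin (sp S) (B f) \<and> B f \<subseteq> A \<and>
      is_localization (Sec S A) f (Sec S (B f)) (Res S A (B f))"
    and B3: "B \<zero>\<^bsub>Sec S A\<^esub> = {}"
    and B4: "\<And>Y s. openin (sp S) Y \<Longrightarrow> Y \<subseteq> A \<Longrightarrow> s \<in> Y \<Longrightarrow>
      \<exists>f\<in>carrier (Sec S A). s \<in> B f \<and> B f \<subseteq> Y"
    using B by (simp_all add: basic_opens_def)
  obtain f where f: "f \<in> carrier (Sec S A)" "B f \<noteq> {}" "B f \<subseteq> W"
    using B4 W by blast
  have oB: "openin (sp S) (B f)" using B1 f by blast
  interpret WB: ring_hom_cring "Sec S W" "Sec S (B f)" "Res S W (B f)"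
    using W oB f by (intro res_ring_hom_cring) auto
  have "Res S A (B f) x = Res S W (B f) (Res S A W x)"
    using res_res[OF oA W(1) oB f(3) W(2) x] by simp
  then have "Res S A (B f) x = \<zero>\<^bsub>Sec S (B f)\<^esub>" using xW by simp
  then obtain n :: nat where n: "f [^]\<^bsub>Sec S A\<^esub> n \<otimes>\<^bsub>Sec S A\<^esub> x = \<zero>\<^bsub>Sec S A\<^esub>"
    using B1[OF f(1)] x unfolding is_localization_def by blast
  then have "f [^]\<^bsub>Sec S A\<^esub> n = \<zero>\<^bsub>Sec S A\<^esub>"
    using affine_sections_integral[OF A _ x n] f(1) x0 by simp
  then have "f = \<zero>\<^bsub>Sec S A\<^esub>" using sections_reduced[OF oA f(1)] by blast
  then show False using B3 f(2) by simp
qed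

end

section \<open>The Lie algebra\<close>

locale pdiv_scheme = ringed_scheme S for S :: "('s, 'a) ringed_space" +
  fixes p :: nat and BT :: "('s, 'a, 'b) pdiv"
  assumes pdiv: "p_divisible_group p S BT"
begin

lemma level_res_closed:
  assumes "affine_open S V" "affine_open S W" "W \<subseteq> V" "a \<in> carrier (Sec (level BT n) V)"
  shows "Res (level BT n) V W a \<in> carrier (Sec (level BT n) W)"
proof -
  have "sheaf_of_rings (sp S) (level BT n)"
    using pdiv by (simp add: p_divisible_group_def finite_flat_group_scheme_def)
  then have "Res (level BT n) V W \<in> ring_hom (Sec (level BT n) V) (Sec (level BT n) W)"
    using assms affine_openin by (simp add: sheaf_of_rings_def presheaf_of_rings_def)
  then show ?thesis using assms(4) by (rule ring_hom_closed)
qed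

lemma formal_functions_res:
  assumes "affine_open S V" "affine_open S W" "W \<subseteq> V" "a \<in> formal_functions BT V"
  shows "(\<lambda>n. Res (level BT n) V W (a n)) \<in> formal_functions BT W"
proof -
  have "transition BT n W (Res (level BT (Suc n)) V W b) = Res (level BT n) V W (transition BT n V b)"
    if "b \<in> carrier (Sec (level BT (Suc n)) V)" for n b
    using pdiv assms that by (simp add: p_divisible_group_def)
  then show ?thesis
    using assms level_res_closed by (simp add: formal_functions_def)
qed

lemma End_hopf:
  assumes "f \<in> carrier (End S BT)" "affine_open S V"
  shows "(\<lambda>a. f (n, V, a)) \<in> hopf_homs S (level BT n) (level BT n) V"
  using assms by (simp add: End_def)

lemma End_closed:
  assumes "f \<in> carrier (End S BT)" "affine_open S V" "a \<in> carrier (Sec (level BT n) V)"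
  shows "f (n, V, a) \<in> carrier (Sec (level BT n) V)"
  using End_hopf[OF assms(1,2), of n] assms(3) ring_hom_closed
  by (fastforce simp: hopf_homs_def)

lemma End_formal_functions:
  assumes "f \<in> carrier (End S BT)" "affine_open S V" "a \<in> formal_functions BT V"
  shows "(\<lambda>n. f (n, V, a n)) \<in> formal_functions BT V"
proof -
  have "f (n, V, transition BT n V b) = transition BT n V (f (Suc n, V, b))"
    if "b \<in> carrier (Sec (level BT (Suc n)) V)" for n b
    using assms that by (simp add: End_def)
  then have "transition BT n V (f (Suc n, V, a (Suc n))) = f (n, V, a n)" for n
    using assms(3) by (metis (mono_tags, lifting) formal_functions_def mem_Collect_eq)
  then show ?thesis
    using assms End_closed by (simp add: formal_functions_def)
qed

text \<open>Sections of Lie are extensional, so nested uses of \<open>lie_map\<close> can be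
  evaluated only if the pulled back function stays in \<open>lie_dom\<close>.\<close>

lemma lie_dom_End:
  assumes "f \<in> carrier (End S BT)" "(V, a) \<in> lie_dom S BT U"
  shows "(V, \<lambda>n. f (n, V, a n)) \<in> lie_dom S BT U"
  using assms End_formal_functions by (simp add: lie_dom_def)

lemma lie_dom_mono: "V \<subseteq> U \<Longrightarrow> lie_dom S BT V \<subseteq> lie_dom S BT U"
  by (auto simp: lie_dom_def)

section \<open>Endomorphisms and scalars acting on sections of Lie\<close>

lemma Lie_value_closed:
  assumes "D \<in> Lie S BT U" "(V, a) \<in> lie_dom S BT U"
  shows "D (V, a) \<in> carrier (Sec S V)"
proof -
  have V: "affine_open S V" "V \<subseteq> U" "a \<in> formal_functions BT V"
    using assms(2) by (auto simp: lie_dom_def)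
  then obtain n \<delta> where "\<delta> \<in> point_derivations S (level BT n) V" "D (V, a) = \<delta> (a n)"
    using assms(1) unfolding Lie_def by blast
  then show ?thesis using V(3) by (auto simp: point_derivations_def formal_functions_def)
qed

lemma Lie_extensional: "D \<in> Lie S BT U \<Longrightarrow> D \<in> extensional (lie_dom S BT U)"
  by (simp add: Lie_def)

lemma Lie_res:
  assumes "D \<in> Lie S BT U" "affine_open S V" "affine_open S W" "W \<subseteq> V" "V \<subseteq> U"
    "a \<in> formal_functions BT V"
  shows "D (W, \<lambda>n. Res (level BT n) V W (a n)) = Res S V W (D (V, a))"
  using assms by (simp add: Lie_def)

text \<open>Two reversals cancel: \<open>lie_map\<close> precomposes with pullbacks, and the product
  in \<open>End S BT\<close> composes pullbacks in reverse order.\<close>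

lemma lie_map_mult:
  assumes "f \<in> carrier (End S BT)"
  shows "lie_map S BT U f (lie_map S BT U g D) = lie_map S BT U (f \<otimes>\<^bsub>End S BT\<^esub> g) D"
proof (rule extensionalityI)
  fix x assume x: "x \<in> lie_dom S BT U"
  obtain V a where [simp]: "x = (V, a)" by fastforce
  have "(n, V, a n) \<in> end_dom S BT" for n
    using x by (simp add: lie_dom_def end_dom_def formal_functions_def)
  then show "lie_map S BT U f (lie_map S BT U g D) x = lie_map S BT U (f \<otimes>\<^bsub>End S BT\<^esub> g) D x"
    using x lie_dom_End[OF assms] by (simp add: lie_map_def End_def)
qed (auto simp: lie_map_def)

lemma lie_map_one:
  assumes "D \<in> extensional (lie_dom S BT U)"
  shows "lie_map S BT U \<one>\<^bsub>End S BT\<^esub> D = D"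
proof (rule extensionalityI)
  fix x assume x: "x \<in> lie_dom S BT U"
  obtain V a where [simp]: "x = (V, a)" by fastforce
  have "(n, V, a n) \<in> end_dom S BT" for n
    using x by (simp add: lie_dom_def end_dom_def formal_functions_def)
  then show "lie_map S BT U \<one>\<^bsub>End S BT\<^esub> D x = D x"
    using x by (simp add: lie_map_def End_def)
qed (use assms in \<open>auto simp: lie_map_def\<close>)

text \<open>The scalar acts on values and the endomorphism on arguments over the same affine open,
  so the two actions commute.\<close>

lemma lie_map_smult:
  assumes "f \<in> carrier (End S BT)"
  shows "lie_map S BT U f (lie_smult S BT U c D) = lie_smult S BT U c (lie_map S BT U f D)"
proof (rule extensionalityI)
  fix x assume x: "x \<in> lie_dom S BT U"
  obtain V a where [simp]: "x = (V, a)" by fastforce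
  show "lie_map S BT U f (lie_smult S BT U c D) x = lie_smult S BT U c (lie_map S BT U f D) x"
    using x lie_dom_End[OF assms] by (simp add: lie_map_def lie_smult_def)
qed (auto simp: lie_map_def lie_smult_def)

lemma lie_map_restrict:
  assumes "f \<in> carrier (End S BT)" "V \<subseteq> U"
  shows "lie_map S BT V f (restrict D (lie_dom S BT V)) = restrict (lie_map S BT U f D) (lie_dom S BT V)"
proof (rule extensionalityI)
  fix x assume x: "x \<in> lie_dom S BT V"
  obtain W a where [simp]: "x = (W, a)" by fastforce
  show "lie_map S BT V f (restrict D (lie_dom S BT V)) x = restrict (lie_map S BT U f D) (lie_dom S BT V) x"
    using x lie_dom_End[OF assms(1)] lie_dom_mono[OF assms(2)] by (auto simp: lie_map_def)
qed (auto simp: lie_map_def)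

lemma lie_smult_restrict:
  assumes "openin (sp S) U" "openin (sp S) V" "V \<subseteq> U" "c \<in> carrier (Sec S U)"
  shows "lie_smult S BT V (Res S U V c) (restrict D (lie_dom S BT V))
    = restrict (lie_smult S BT U c D) (lie_dom S BT V)"
proof (rule extensionalityI)
  fix x assume x: "x \<in> lie_dom S BT V"
  obtain W a where [simp]: "x = (W, a)" by fastforce
  have W: "openin (sp S) W" "W \<subseteq> V"
    using x affine_openin by (auto simp: lie_dom_def)
  show "lie_smult S BT V (Res S U V c) (restrict D (lie_dom S BT V)) x
    = restrict (lie_smult S BT U c D) (lie_dom S BT V) x"
    using x lie_dom_mono[OF assms(3)] res_res[OF assms(1,2) W assms(3,4)]
    by (auto simp: lie_smult_def)
qed (auto simp: lie_smult_def)

lemma lie_smult_smult: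
  assumes "openin (sp S) U" "c \<in> carrier (Sec S U)" "c' \<in> carrier (Sec S U)" "D \<in> Lie S BT U"
  shows "lie_smult S BT U c (lie_smult S BT U c' D) = lie_smult S BT U (c \<otimes>\<^bsub>Sec S U\<^esub> c') D"
proof (rule extensionalityI)
  fix x assume x: "x \<in> lie_dom S BT U"
  obtain V a where [simp]: "x = (V, a)" by fastforce
  have V: "openin (sp S) V" "V \<subseteq> U"
    using x affine_openin by (auto simp: lie_dom_def)
  interpret UV: ring_hom_cring "Sec S U" "Sec S V" "Res S U V"
    using assms V by (intro res_ring_hom_cring)
  show "lie_smult S BT U c (lie_smult S BT U c' D) x = lie_smult S BT U (c \<otimes>\<^bsub>Sec S U\<^esub> c') D x"
    using x assms Lie_value_closed[OF assms(4)] by (simp add: lie_smult_def UV.S.m_assoc)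
qed (auto simp: lie_smult_def)

lemma lie_smult_one:
  assumes "openin (sp S) U" "D \<in> Lie S BT U"
  shows "lie_smult S BT U \<one>\<^bsub>Sec S U\<^esub> D = D"
proof (rule extensionalityI)
  fix x assume x: "x \<in> lie_dom S BT U"
  obtain V a where [simp]: "x = (V, a)" by fastforce
  have V: "openin (sp S) V" "V \<subseteq> U"
    using x affine_openin by (auto simp: lie_dom_def)
  interpret UV: ring_hom_cring "Sec S U" "Sec S V" "Res S U V"
    using assms V by (intro res_ring_hom_cring)
  show "lie_smult S BT U \<one>\<^bsub>Sec S U\<^esub> D x = D x"
    using x Lie_value_closed[OF assms(2)] by (simp add: lie_smult_def)
qed (use Lie_extensional[OF assms(2)] in \<open>auto simp: lie_smult_def\<close>)

lemma lie_smult_zero: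
  assumes "openin (sp S) U" "D \<in> Lie S BT U"
  shows "lie_smult S BT U \<zero>\<^bsub>Sec S U\<^esub> D = lie_zero S BT U"
proof (rule extensionalityI)
  fix x assume x: "x \<in> lie_dom S BT U"
  obtain V a where [simp]: "x = (V, a)" by fastforce
  have V: "openin (sp S) V" "V \<subseteq> U"
    using x affine_openin by (auto simp: lie_dom_def)
  interpret UV: ring_hom_cring "Sec S U" "Sec S V" "Res S U V"
    using assms V by (intro res_ring_hom_cring)
  show "lie_smult S BT U \<zero>\<^bsub>Sec S U\<^esub> D x = lie_zero S BT U x"
    using x Lie_value_closed[OF assms(2)] by (simp add: lie_smult_def lie_zero_def)
qed (auto simp: lie_smult_def lie_zero_def)

section \<open>Stability of Lie under restriction and endomorphisms\<close>

lemma Lie_restrict: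
  assumes "D \<in> Lie S BT U" "V \<subseteq> U"
  shows "restrict D (lie_dom S BT V) \<in> Lie S BT V"
proof -
  have "\<exists>n. \<exists>\<delta>\<in>point_derivations S (level BT n) W. \<forall>a\<in>formal_functions BT W.
      restrict D (lie_dom S BT V) (W, a) = \<delta> (a n)" if W: "affine_open S W" "W \<subseteq> V" for W
  proof -
    have "W \<subseteq> U" using W assms by blast
    then obtain n \<delta> where "\<delta> \<in> point_derivations S (level BT n) W"
      "\<forall>a\<in>formal_functions BT W. D (W, a) = \<delta> (a n)"
      using assms(1) W unfolding Lie_def by blast
    then show ?thesis using W by (intro exI[of _ n] bexI[of _ \<delta>]) (auto simp: lie_dom_def)
  qed
  moreover have "restrict D (lie_dom S BT V) (W', \<lambda>n. Res (level BT n) W W' (a n))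
      = Res S W W' (restrict D (lie_dom S BT V) (W, a))"
    if W: "affine_open S W" "affine_open S W'" "W' \<subseteq> W" "W \<subseteq> V" "a \<in> formal_functions BT W"
    for W W' a
  proof -
    have "W \<subseteq> U" using W assms by blast
    then have "D (W', \<lambda>n. Res (level BT n) W W' (a n)) = Res S W W' (D (W, a))"
      using Lie_res[OF assms(1)] W by blast
    moreover have "(W, a) \<in> lie_dom S BT V" "(W', \<lambda>n. Res (level BT n) W W' (a n)) \<in> lie_dom S BT V"
      using W formal_functions_res by (auto simp: lie_dom_def)
    ultimately show ?thesis by simp
  qed
  ultimately show ?thesis unfolding Lie_def by blast
qed

text \<open>A Hopf algebra endomorphism respects the counit, which preserves the Leibniz rule along
  the zero section, and fixes the scalars, which preserves linearity.\<close>

lemma point_derivations_End: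
  assumes "f \<in> carrier (End S BT)" "affine_open S V" "\<delta> \<in> point_derivations S (level BT n) V"
  shows "(\<lambda>a. \<delta> (f (n, V, a))) \<in> point_derivations S (level BT n) V"
proof -
  let ?R = "Sec (level BT n) V" and ?G = "level BT n"
  have f: "(\<lambda>a. f (n, V, a)) \<in> ring_hom ?R ?R"
    "\<And>r. r \<in> carrier (Sec S V) \<Longrightarrow> f (n, V, unit_map ?G V r) = unit_map ?G V r"
    "\<And>a. a \<in> carrier ?R \<Longrightarrow> counit ?G V (f (n, V, a)) = counit ?G V a"
    using End_hopf[OF assms(1,2), of n] by (auto simp: hopf_homs_def)
  have unit: "unit_map ?G V r \<in> carrier ?R" if "r \<in> carrier (Sec S V)" for r
  proof -
    have "unit_map ?G V \<in> ring_hom (Sec S V) ?R"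
      using pdiv assms(2) affine_openin
      by (simp add: p_divisible_group_def finite_flat_group_scheme_def)
    then show ?thesis using that by (rule ring_hom_closed)
  qed
  have closed: "f (n, V, a) \<in> carrier ?R" if "a \<in> carrier ?R" for a
    using End_closed[OF assms(1,2) that] .
  have "\<delta> (f (n, V, unit_map ?G V r \<otimes>\<^bsub>?R\<^esub> a)) = r \<otimes>\<^bsub>Sec S V\<^esub> \<delta> (f (n, V, a))"
    if "r \<in> carrier (Sec S V)" "a \<in> carrier ?R" for r a
  proof -
    have "f (n, V, unit_map ?G V r \<otimes>\<^bsub>?R\<^esub> a) = unit_map ?G V r \<otimes>\<^bsub>?R\<^esub> f (n, V, a)"
      using ring_hom_mult[OF f(1) unit that(2)] f(2) that by simp
    then show ?thesis
      using assms(3) that closed unfolding point_derivations_def by auto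
  qed
  then show ?thesis
    using assms(3) ring_hom_mult[OF f(1)] ring_hom_add[OF f(1)] f(3) closed
    unfolding point_derivations_def by (auto simp: Pi_def)
qed

text \<open>An endomorphism acts level by level, so the derivation still factors through the same
  level; compatibility with restriction is inherited from both \<open>f\<close> and
  \<open>D\<close>.\<close>

lemma Lie_lie_map:
  assumes f: "f \<in> carrier (End S BT)" and D: "D \<in> Lie S BT U"
  shows "lie_map S BT U f D \<in> Lie S BT U"
proof -
  have "\<exists>n. \<exists>\<delta>\<in>point_derivations S (level BT n) V. \<forall>a\<in>formal_functions BT V.
      lie_map S BT U f D (V, a) = \<delta> (a n)" if V: "affine_open S V" "V \<subseteq> U" for V
  proof -
    obtain n \<delta> where \<delta>: "\<delta> \<in> point_derivations S (level BT n) V"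
      "\<forall>a\<in>formal_functions BT V. D (V, a) = \<delta> (a n)"
      using D V unfolding Lie_def by blast
    then show ?thesis
      using V point_derivations_End[OF f V(1) \<delta>(1)] End_formal_functions[OF f V(1)]
      by (intro exI[of _ n] bexI[of _ "\<lambda>a. \<delta> (f (n, V, a))"]) (auto simp: lie_dom_def lie_map_def)
  qed
  moreover have "lie_map S BT U f D (W, \<lambda>n. Res (level BT n) V W (a n))
      = Res S V W (lie_map S BT U f D (V, a))"
    if V: "affine_open S V" "affine_open S W" "W \<subseteq> V" "V \<subseteq> U" "a \<in> formal_functions BT V"
    for V W a
  proof -
    have "f (n, W, Res (level BT n) V W (a n)) = Res (level BT n) V W (f (n, V, a n))" for n
      using f V by (simp add: End_def formal_functions_def)
    moreover have "D (W, \<lambda>n. Res (level BT n) V W (f (n, V, a n))) = Res S V W (D (V, \<lambda>n. f (n, V, a n)))"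
      using Lie_res[OF D V(1-4) End_formal_functions[OF f V(1,5)]] .
    moreover have "(V, a) \<in> lie_dom S BT U" "(W, \<lambda>n. Res (level BT n) V W (a n)) \<in> lie_dom S BT U"
      using V formal_functions_res by (auto simp: lie_dom_def)
    ultimately show ?thesis by (simp add: lie_map_def)
  qed
  moreover have "lie_map S BT U f D \<in> extensional (lie_dom S BT U)"
    by (simp add: lie_map_def)
  ultimately show ?thesis unfolding Lie_def by blast
qed

section \<open>Local generators of an invertible subsheaf\<close>

text \<open>This is the inner clause of \<open>invertible_subsheaf\<close> with the open set and the
  section fixed, so that generators of all parts can be chosen at once.\<close>

definition lie_generator ::
  "('s set \<Rightarrow> ('s set \<times> (nat \<Rightarrow> 'b) \<Rightarrow> 'a) set) \<Rightarrow> 's set \<Rightarrow> ('s set \<times> (nat \<Rightarrow> 'b) \<Rightarrow> 'a) \<Rightarrow> bool"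
  where
  "lie_generator L U D\<^sub>0 \<longleftrightarrow> (\<forall>V. openin (sp S) V \<and> V \<subseteq> U \<longrightarrow>
     (\<forall>c \<in> carrier (Sec S V). lie_smult S BT V c (restrict D\<^sub>0 (lie_dom S BT V)) \<in> L V) \<and>
     (\<forall>D \<in> L V. \<exists>!c. c \<in> carrier (Sec S V) \<and>
        D = lie_smult S BT V c (restrict D\<^sub>0 (lie_dom S BT V))))"

lemma lie_generator_coeff:
  assumes "lie_generator L U D\<^sub>0" "openin (sp S) V" "V \<subseteq> U" "D \<in> L V"
  obtains c where "c \<in> carrier (Sec S V)"
    "D = lie_smult S BT V c (restrict D\<^sub>0 (lie_dom S BT V))"
proof -
  have "\<exists>!c. c \<in> carrier (Sec S V) \<and> D = lie_smult S BT V c (restrict D\<^sub>0 (lie_dom S BT V))"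
    using assms by (simp add: lie_generator_def)
  then show ?thesis using that by (elim ex1E) blast
qed

text \<open>Sections of the Lie algebra are only tested on affine opens, so uniqueness of coefficients
  already forces small affine opens to exist: otherwise 0 and 1 would be coefficients of the same
  section. This replaces the fact that basic open sets are affine.\<close>

lemma lie_generator_affine:
  assumes "lie_generator L U D\<^sub>0" and V: "openin (sp S) V" "V \<subseteq> U" "V \<noteq> {}"
  shows "\<exists>W. affine_open S W \<and> W \<subseteq> V \<and> W \<noteq> {}"
proof (rule ccontr)
  assume none: "\<not> ?thesis"
  let ?R = "Sec S V" and ?D = "restrict D\<^sub>0 (lie_dom S BT V)"
  interpret cring ?R using V(1) by (rule sections_cring)
  \<comment> \<open>The empty set may itself be an affine open inside \<open>V\<close>, so the
    coefficients 1 and 0 must be compared there too.\<close>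
  have "Res S V {} \<one>\<^bsub>?R\<^esub> = Res S V {} \<zero>\<^bsub>?R\<^esub>"
    using res_hom[of V "{}"] V(1) by (intro sections_empty) (auto intro: ring_hom_closed)
  then have "lie_smult S BT V \<one>\<^bsub>?R\<^esub> ?D = lie_smult S BT V \<zero>\<^bsub>?R\<^esub> ?D"
    using none unfolding lie_smult_def by (intro restrict_ext) (auto simp: lie_dom_def)
  moreover have "\<exists>!c. c \<in> carrier ?R \<and> lie_smult S BT V \<one>\<^bsub>?R\<^esub> ?D = lie_smult S BT V c ?D"
    using assms(1) V by (simp add: lie_generator_def)
  ultimately have "\<one>\<^bsub>?R\<^esub> = \<zero>\<^bsub>?R\<^esub>" using one_closed zero_closed by blast
  then show False using sections_nontrivial V by blast
qed

end

section \<open>Special formal modules\<close>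

context drinfeld_data
begin

section \<open>Frobenius on the integers of \<open>Ed\<close> and the parts of Lie\<close>

text \<open>Write \<open>z x\<close> as a fraction whose denominator is the image of 1. The work is
  to check that the cosets of 1 form a nonzero point of the inverse limit.\<close>

lemma z_in_E:
  assumes x: "x \<in> carrier (Zp p)"
  shows "z x \<in> E"
proof -
  interpret M: algebraic_closure M E by (fact M_closure)
  have mem: "y \<in> \<one>\<^bsub>Zp p\<^esub> n \<longleftrightarrow> (\<exists>t. y = t * int p ^ n + 1)" for y n
  proof -
    have "int p [^]\<^bsub>\<Z>\<^esub> n = int p ^ n"
      by (induction n) (simp_all add: nat_pow_def mult.commute)
    then show ?thesis
      by (auto simp: Zp_def adic_completion_def Let_def FactRing_def a_r_coset_def' cgenideal_def)
  qed
  have one: "\<one>\<^bsub>Zp p\<^esub> \<in> carrier (Zp p)"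
  proof -
    have "\<one>\<^bsub>Zp p\<^esub> (Suc n) \<subseteq> \<one>\<^bsub>Zp p\<^esub> n" for n
      unfolding subset_iff mem by (metis power_Suc mult.assoc)
    moreover have "\<one>\<^bsub>Zp p\<^esub> n \<in> carrier (\<Z> Quot (PIdl\<^bsub>\<Z>\<^esub> (int p [^]\<^bsub>\<Z>\<^esub> n)))" for n
      by (auto simp: Zp_def adic_completion_def Let_def FactRing_def A_RCOSETS_def')
    ultimately show ?thesis by (simp add: Zp_def adic_completion_def Let_def)
  qed
  have "\<one>\<^bsub>Zp p\<^esub> \<noteq> \<zero>\<^bsub>Zp p\<^esub>"
  proof
    assume eq: "\<one>\<^bsub>Zp p\<^esub> = \<zero>\<^bsub>Zp p\<^esub>"
    \<comment> \<open>Level 1 is the first at which 1 and 0 differ, the quotient at level 0 being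
      trivial.\<close>
    have "0 \<in> \<zero>\<^bsub>Zp p\<^esub> 1"
      by (auto simp: Zp_def adic_completion_def Let_def FactRing_def cgenideal_def)
    then obtain t where "0 = t * int p ^ 1 + 1" using mem eq by metis
    then have "int p dvd 1"
      by (metis add.commute add_eq_0_iff dvd_minus_iff dvd_triv_right power_one_right)
    then show False using prime_p by auto
  qed
  then have "z x \<otimes>\<^bsub>M\<^esub> inv\<^bsub>M\<^esub> (z \<one>\<^bsub>Zp p\<^esub>) \<in> Qp_in p M z"
    using x one unfolding Qp_in_def by blast
  moreover have "z \<one>\<^bsub>Zp p\<^esub> = \<one>\<^bsub>M\<^esub>" "z x \<in> carrier M"
    using ring_hom_one[OF z_hom] ring_hom_closed[OF z_hom x] by simp_all
  ultimately show ?thesis using Qp_sub by auto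
qed

text \<open>\<open>\<sigma>\<close> fixes \<open>E\<close>, which contains the coefficients of every
  integral equation, so by injectivity \<open>b\<close> and \<open>\<sigma> b\<close> satisfy the
  same monic equations.\<close>

lemma Ed_subset: "Ed \<subseteq> carrier M"
  and sigma_bij: "bij_betw \<sigma> Ed Ed"
  and integral_over_sigma:
    "b \<in> Ed \<Longrightarrow> integral_over M (z ` carrier (Zp p)) (\<sigma> b) \<longleftrightarrow> integral_over M (z ` carrier (Zp p)) b"
proof -
  interpret M: algebraic_closure M E by (fact M_closure)
  have "subfield Ed M" and E_Ed: "E \<subseteq> Ed"
    using Ed_unram by (simp_all add: finite_unramified_def)
  note Ed = subringE[OF subfieldE(1)[OF this(1)]]
  show "Ed \<subseteq> carrier M" by (fact Ed(1))
  then have Ed_M: "x \<in> carrier M" if "x \<in> Ed" for x using that by blast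
  have "\<sigma> \<in> ring_iso (M\<lparr>carrier := Ed\<rparr>) (M\<lparr>carrier := Ed\<rparr>)" and fixed: "\<And>x. x \<in> E \<Longrightarrow> \<sigma> x = x"
    using sigma_aut by (auto simp: field_auts_def)
  then have hom: "\<sigma> \<in> ring_hom (M\<lparr>carrier := Ed\<rparr>) (M\<lparr>carrier := Ed\<rparr>)" and bij: "bij_betw \<sigma> Ed Ed"
    by (auto simp: ring_iso_def)
  show "bij_betw \<sigma> Ed Ed" by (fact bij)
  have mult: "\<sigma> (x \<otimes>\<^bsub>M\<^esub> y) = \<sigma> x \<otimes>\<^bsub>M\<^esub> \<sigma> y" and add: "\<sigma> (x \<oplus>\<^bsub>M\<^esub> y) = \<sigma> x \<oplus>\<^bsub>M\<^esub> \<sigma> y"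
    if "x \<in> Ed" "y \<in> Ed" for x y
    using ring_hom_mult[OF hom] ring_hom_add[OF hom] that by simp_all
  have closed: "\<sigma> x \<in> Ed" if "x \<in> Ed" for x using bij that by (auto simp: bij_betw_def)
  have one: "\<sigma> \<one>\<^bsub>M\<^esub> = \<one>\<^bsub>M\<^esub>" using ring_hom_one[OF hom] by simp
  \<comment> \<open>Preservation of 0 is not a clause of \<open>ring_hom\<close>; here it follows
    because \<open>\<sigma>\<close> fixes \<open>E\<close>.\<close>
  have "\<zero>\<^bsub>M\<^esub> \<in> E"
    using subringE(2)[OF subfieldE(1)[OF M.subfield_axioms]] .
  then have zero: "\<sigma> \<zero>\<^bsub>M\<^esub> = \<zero>\<^bsub>M\<^esub>" using fixed by auto
  have pow: "x [^]\<^bsub>M\<^esub> n \<in> Ed \<and> \<sigma> (x [^]\<^bsub>M\<^esub> n) = \<sigma> x [^]\<^bsub>M\<^esub> n" if "x \<in> Ed" for x and n :: nat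
    using that by (induction n) (auto simp: one mult Ed)
  have sum: "finsum M g A \<in> Ed \<and> \<sigma> (finsum M g A) = finsum M (\<lambda>i. \<sigma> (g i)) A"
    if "finite A" "g \<in> A \<rightarrow> Ed" for g and A :: "nat set"
    using that
  proof induction
    case empty
    then show ?case by (simp add: zero Ed)
  next
    case (insert i A)
    then show ?case
      using Ed_M closed by (auto simp: Pi_iff M.finsum_insert add Ed)
  qed
  show "integral_over M (z ` carrier (Zp p)) (\<sigma> b) \<longleftrightarrow> integral_over M (z ` carrier (Zp p)) b"
    if b: "b \<in> Ed"
  proof -
    have "\<sigma> b [^]\<^bsub>M\<^esub> n \<oplus>\<^bsub>M\<^esub> (\<Oplus>\<^bsub>M\<^esub>i\<in>{..<n}. c i \<otimes>\<^bsub>M\<^esub> \<sigma> b [^]\<^bsub>M\<^esub> i) = \<zero>\<^bsub>M\<^esub> \<longleftrightarrow>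
        b [^]\<^bsub>M\<^esub> n \<oplus>\<^bsub>M\<^esub> (\<Oplus>\<^bsub>M\<^esub>i\<in>{..<n}. c i \<otimes>\<^bsub>M\<^esub> b [^]\<^bsub>M\<^esub> i) = \<zero>\<^bsub>M\<^esub>"
      if c: "c \<in> {..<n} \<rightarrow> z ` carrier (Zp p)" for n :: nat and c
    proof -
      have cE: "c i \<in> E" if "i < n" for i
      proof -
        have "c i \<in> z ` carrier (Zp p)" using c that by auto
        then show ?thesis by (rule imageE) (simp add: z_in_E)
      qed
      let ?g = "\<lambda>i. c i \<otimes>\<^bsub>M\<^esub> b [^]\<^bsub>M\<^esub> i"
      have g: "?g \<in> {..<n} \<rightarrow> Ed" 
        using cE E_Ed pow[OF b] by (intro Pi_I Ed(6)) auto
      have "(\<Oplus>\<^bsub>M\<^esub>i\<in>{..<n}. \<sigma> (?g i)) = (\<Oplus>\<^bsub>M\<^esub>i\<in>{..<n}. c i \<otimes>\<^bsub>M\<^esub> \<sigma> b [^]\<^bsub>M\<^esub> i)"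
      proof (rule M.finsum_cong')
        show "(\<lambda>i. c i \<otimes>\<^bsub>M\<^esub> \<sigma> b [^]\<^bsub>M\<^esub> i) \<in> {..<n} \<rightarrow> carrier M"
          using cE E_Ed Ed_M closed[OF b] by auto
        fix i assume "i \<in> {..<n}"
        then show "\<sigma> (?g i) = c i \<otimes>\<^bsub>M\<^esub> \<sigma> b [^]\<^bsub>M\<^esub> i"
          using cE[of i] E_Ed pow[OF b, of i] mult[of "c i"] fixed by auto
      qed simp
      then have "\<sigma> (b [^]\<^bsub>M\<^esub> n \<oplus>\<^bsub>M\<^esub> finsum M ?g {..<n})
          = \<sigma> b [^]\<^bsub>M\<^esub> n \<oplus>\<^bsub>M\<^esub> (\<Oplus>\<^bsub>M\<^esub>i\<in>{..<n}. c i \<otimes>\<^bsub>M\<^esub> \<sigma> b [^]\<^bsub>M\<^esub> i)"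
        using add[of "b [^]\<^bsub>M\<^esub> n" "finsum M ?g {..<n}"] pow[OF b, of n] sum[OF _ g] by simp
      moreover have "b [^]\<^bsub>M\<^esub> n \<oplus>\<^bsub>M\<^esub> finsum M ?g {..<n} \<in> Ed"
        using pow[OF b, of n] sum[OF _ g] Ed by simp
      ultimately show ?thesis
        using bij zero Ed(2) unfolding bij_betw_def inj_on_def by metis
    qed
    then show ?thesis unfolding integral_over_def by blast
  qed
qed

text \<open>Gives a preimage \<open>b\<close> of \<open>a\<close> to which \<open>v_comm\<close>
  applies, turning \<open>j a\<close> times \<open>v\<close> into \<open>v\<close> times
  \<open>j b\<close>.\<close>

lemma sigma_surj_integers:
  assumes "a \<in> carrier (integers p M z Ed)"
  shows "\<exists>b\<in>carrier (integers p M z Ed). \<sigma> b = a"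
proof -
  have "a \<in> \<sigma> ` Ed"
    using assms sigma_bij by (simp add: integers_def bij_betw_def)
  then obtain b where "b \<in> Ed" "\<sigma> b = a" by blast
  then show ?thesis
    using assms Ed_subset integral_over_sigma[of b] by (auto simp: integers_def)
qed

text \<open>Keeps the argument of \<open>\<psi>\<close> where \<open>psi_hom\<close> controls
  it.\<close>

lemma sigma_pow_integers:
  assumes "a \<in> carrier (integers p M z Ed)"
  shows "(\<sigma> ^^ i) a \<in> carrier (integers p M z Ed)"
proof (induction i)
  case 0
  then show ?case using assms by simp
next
  case (Suc i)
  then show ?case
    using Ed_subset integral_over_sigma sigma_bij by (auto simp: integers_def bij_betw_def)
qed

text \<open>With the conventions in force, \<open>\<Pi>\<close> lowers the index: \<open>a \<Pi> = \<Pi> \<sigma>\<^sup>-\<^sup>1(a)\<close>.\<close>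

lemma Lie_part_shift:
  assumes "pdiv_scheme S p BT" and \<iota>: "\<iota> \<in> ring_hom OD (End S BT)"
    and D: "D \<in> Lie_part S \<beta> BT \<iota> (Suc i) U"
  shows "lie_map S BT U (\<iota> v) D \<in> Lie_part S \<beta> BT \<iota> i U"
proof -
  interpret pdiv_scheme S p BT by (fact assms(1))
  have End: "\<iota> x \<in> carrier (End S BT)" if "x \<in> carrier OD" for x
    using \<iota> that by (rule ring_hom_closed)
  have DL: "D \<in> Lie S BT U" using D by (simp add: Lie_part_def)
  have "lie_map S BT U (\<iota> (j a)) (lie_map S BT U (\<iota> v) D)
      = base_smult S \<beta> BT U (\<psi> ((\<sigma> ^^ i) a)) (lie_map S BT U (\<iota> v) D)"
    if a: "a \<in> carrier (integers p M z Ed)" for a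
  proof -
    obtain b where b: "b \<in> carrier (integers p M z Ed)" "\<sigma> b = a"
      using sigma_surj_integers[OF a] by blast
    have jc: "j a \<in> carrier OD" "j b \<in> carrier OD" using ring_hom_closed[OF j_hom] a b(1) by simp_all
    have "lie_map S BT U (\<iota> (j a)) (lie_map S BT U (\<iota> v) D) = lie_map S BT U (\<iota> (j a \<otimes>\<^bsub>OD\<^esub> v)) D"
      using lie_map_mult End jc v_in ring_hom_mult[OF \<iota>] by simp
    also have "j a \<otimes>\<^bsub>OD\<^esub> v = v \<otimes>\<^bsub>OD\<^esub> j b" using v_comm b by simp
    also have "lie_map S BT U (\<iota> (v \<otimes>\<^bsub>OD\<^esub> j b)) D = lie_map S BT U (\<iota> v) (lie_map S BT U (\<iota> (j b)) D)"
      using lie_map_mult End jc v_in ring_hom_mult[OF \<iota>] by simp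
    also have "lie_map S BT U (\<iota> (j b)) D = base_smult S \<beta> BT U (\<psi> ((\<sigma> ^^ Suc i) b)) D"
      using D b(1) unfolding Lie_part_def by blast
    also have "(\<sigma> ^^ Suc i) b = (\<sigma> ^^ i) a" by (simp add: funpow_swap1 b(2))
    finally show ?thesis
      using lie_map_smult[OF End[OF v_in]] by (simp add: base_smult_def)
  qed
  then show ?thesis
    using Lie_lie_map[OF End[OF v_in] DL] by (simp add: Lie_part_def)
qed

text \<open>Both sides of the equation defining a part restrict: the endomorphism acts compatibly,
  and the scalar over \<open>V\<close> is the restriction of the one over \<open>U\<close>, as both
  come from one global section.\<close>

lemma Lie_part_restrict:
  assumes "pdiv_scheme S p BT" and \<iota>: "\<iota> \<in> ring_hom OD (End S BT)"
    and \<beta>: "\<beta> \<in> ring_hom (O_breve p M z E w) (global_sections S)"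
    and D: "D \<in> Lie_part S \<beta> BT \<iota> i U" and UV: "openin (sp S) U" "openin (sp S) V" "V \<subseteq> U"
  shows "restrict D (lie_dom S BT V) \<in> Lie_part S \<beta> BT \<iota> i V"
proof -
  interpret pdiv_scheme S p BT by (fact assms(1))
  have "lie_map S BT V (\<iota> (j a)) (restrict D (lie_dom S BT V))
      = base_smult S \<beta> BT V (\<psi> ((\<sigma> ^^ i) a)) (restrict D (lie_dom S BT V))"
    if a: "a \<in> carrier (integers p M z Ed)" for a
  proof -
    let ?b = "\<beta> (\<psi> ((\<sigma> ^^ i) a))" and ?T = "topspace (sp S)"
    have T: "U \<subseteq> ?T" using UV(1) by (rule openin_subset)
    have b: "?b \<in> carrier (Sec S ?T)"
      using ring_hom_closed[OF \<beta> ring_hom_closed[OF psi_hom sigma_pow_integers[OF a]]] .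
    then have "Res S ?T U ?b \<in> carrier (Sec S U)"
      using res_hom[of ?T U] UV(1) T ring_hom_closed by fastforce
    then have "base_smult S \<beta> BT V (\<psi> ((\<sigma> ^^ i) a)) (restrict D (lie_dom S BT V))
        = restrict (base_smult S \<beta> BT U (\<psi> ((\<sigma> ^^ i) a)) D) (lie_dom S BT V)"
      using lie_smult_restrict[OF UV, of "Res S ?T U ?b"] res_res[of ?T U V ?b] UV T b
      by (simp add: base_smult_def)
    moreover have "\<iota> (j a) \<in> carrier (End S BT)"
      using ring_hom_closed[OF \<iota> ring_hom_closed[OF j_hom a]] .
    ultimately show ?thesis
      using lie_map_restrict[of "\<iota> (j a)" V U D] UV D a by (simp add: Lie_part_def)
  qed
  then show ?thesis
    using Lie_restrict[of D U V] D UV(3) by (simp add: Lie_part_def)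
qed

section \<open>Vanishing of \<Pi>^d on Lie\<close>

lemma lie_map_uniformizer_pow:
  assumes "pdiv_scheme S p BT" and \<iota>: "\<iota> \<in> ring_hom OD (End S BT)" and "D \<in> Lie S BT U"
  shows "(lie_map S BT U (\<iota> v) ^^ n) D = lie_map S BT U (\<iota> (v [^]\<^bsub>OD\<^esub> n)) D"
proof -
  interpret pdiv_scheme S p BT by (fact assms(1))
  interpret OD: ring OD by (fact OD_ring)
  show ?thesis
    using assms(3)
  proof (induction n arbitrary: D)
    case 0
    then show ?case using lie_map_one Lie_extensional ring_hom_one[OF \<iota>] by simp
  next
    case (Suc n)
    have End: "\<iota> x \<in> carrier (End S BT)" if "x \<in> carrier OD" for x
      using \<iota> that by (rule ring_hom_closed)
    have "(lie_map S BT U (\<iota> v) ^^ Suc n) D = (lie_map S BT U (\<iota> v) ^^ n) (lie_map S BT U (\<iota> v) D)"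
      by (simp add: funpow_swap1)
    also have "\<dots> = lie_map S BT U (\<iota> (v [^]\<^bsub>OD\<^esub> n)) (lie_map S BT U (\<iota> v) D)"
      using Suc Lie_lie_map End v_in by blast
    also have "\<dots> = lie_map S BT U (\<iota> (v [^]\<^bsub>OD\<^esub> Suc n)) D"
      using lie_map_mult[OF End] ring_hom_mult[OF \<iota>] v_in by simp
    finally show ?case .
  qed
qed

text \<open>The kernel of \<open>red\<close> is generated by the image of \<open>w\<close>, and
  \<open>\<psi>\<close> agrees with the structural embedding on the integers of
  \<open>E\<close>.\<close>

lemma red_psi_uniformizer: "red (\<psi> w) = \<zero>\<^bsub>k\<^esub>"
proof -
  have "w \<in> carrier (integers p M z E)" using w_unif by (simp add: uniformizer_def)
  moreover have "to_O_breve p M z E w w \<in> a_kernel (O_breve p M z E w) k red"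
    unfolding red_ker by (auto simp: genideal_def)
  ultimately show ?thesis using psi_O by (simp add: a_kernel_def')
qed

text \<open>The \<open>d\<close>-th power of \<open>v\<close> is \<open>j w\<close>, which acts on
  Lie through the structure map. That map factors through \<open>red\<close> and so sends
  \<open>\<psi> w\<close> to 0.\<close>

lemma lie_map_uniformizer_nilpotent:
  assumes special: "special_formal_module S (\<kappa> \<circ> red) BT \<iota>" and \<kappa>: "scheme_over k S \<kappa>"
    and U: "openin (sp S) U" and D: "D \<in> Lie S BT U"
  shows "(lie_map S BT U (\<iota> v) ^^ d) D = lie_zero S BT U"
proof -
  interpret pdiv_scheme S p BT
    using special
    by unfold_locales (auto simp: special_formal_module_def scheme_over_def formal_p_divisible_group_def)
  have \<iota>: "\<iota> \<in> ring_hom OD (End S BT)"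
    and act: "\<And>r. r \<in> carrier (integers p M z E) \<Longrightarrow>
      lie_map S BT U (\<iota> (j r)) D = base_smult S (\<kappa> \<circ> red) BT U (\<psi> r) D"
    using special U D by (auto simp: special_formal_module_def)
  have w: "w \<in> carrier (integers p M z E)" using w_unif by (simp add: uniformizer_def)
  interpret k: field k by (fact k_field)
  interpret TU: ring_hom_cring "global_sections S" "Sec S U" "Res S (topspace (sp S)) U"
    using U openin_subset[OF U] by (intro res_ring_hom_cring) auto
  have "\<kappa> \<zero>\<^bsub>k\<^esub> = \<zero>\<^bsub>global_sections S\<^esub>"
    using ring_hom_zero[of \<kappa> k "global_sections S"] \<kappa> k.ring_axioms TU.R.ring_axioms
    by (simp add: scheme_over_def)
  then have "base_smult S (\<kappa> \<circ> red) BT U (\<psi> w) D = lie_zero S BT U"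
    using lie_smult_zero[OF U D] by (simp add: base_smult_def red_psi_uniformizer)
  then show ?thesis
    using lie_map_uniformizer_pow[OF pdiv_scheme_axioms \<iota> D, of d] v_pow act[OF w] by simp
qed

section \<open>Existence of a critical index\<close>

theorem exists_critical_index:
  assumes special: "special_formal_module S (\<kappa> \<circ> red) BT \<iota>" and \<kappa>: "scheme_over k S \<kappa>"
    and irreducible: "irreducible_space (sp S)" and perfect: "perfect_scheme p S"
  shows "\<exists>i<d. critical_index S (\<kappa> \<circ> red) BT \<iota> i"
proof -
  interpret pdiv_scheme S p BT
    using special
    by unfold_locales (auto simp: special_formal_module_def scheme_over_def formal_p_divisible_group_def)
  interpret integral_scheme S p
    using irreducible perfect prime_p by unfold_locales
  let ?L = "\<lambda>i. Lie_part S (\<kappa> \<circ> red) BT \<iota> i"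
  let ?P = "\<lambda>U. lie_map S BT U (\<iota> v)"
  have \<iota>: "\<iota> \<in> ring_hom OD (End S BT)"
    and \<beta>: "\<kappa> \<circ> red \<in> ring_hom (O_breve p M z E w) (global_sections S)"
    and inv: "\<And>i. i < d \<Longrightarrow> invertible_subsheaf S BT (?L i)"
    using special by (auto simp: special_formal_module_def scheme_over_def)
  have v: "\<iota> v \<in> carrier (End S BT)" using \<iota> v_in by (rule ring_hom_closed)
  have L_Lie: "?L i U \<subseteq> Lie S BT U" for i U by (auto simp: Lie_part_def)
  obtain s where s: "s \<in> topspace (sp S)"
    using irreducible unfolding irreducible_space_def by blast
  \<comment> \<open>One point \<open>s\<close> serves for all \<open>d\<close> parts, so that the
    chosen neighbourhoods have a nonempty open intersection.\<close>
  have "\<exists>G. s \<in> G \<and> openin (sp S) G \<and> (\<exists>D\<in>?L i G. lie_generator (?L i) G D)" if "i < d" for i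
    using inv[OF that] s by (simp add: invertible_subsheaf_def lie_generator_def)
  then obtain G D where G: "\<And>i. i < d \<Longrightarrow> s \<in> G i" "\<And>i. i < d \<Longrightarrow> openin (sp S) (G i)"
    and D: "\<And>i. i < d \<Longrightarrow> D i \<in> ?L i (G i)"
    and gen: "\<And>i. i < d \<Longrightarrow> lie_generator (?L i) (G i) (D i)"
    by metis
  have d0: "0 < d" using d_ge2 by simp
  have "openin (sp S) (\<Inter>i\<in>{..<d}. G i)"
    using G(2) d0 by (intro openin_INT2) auto
  moreover have "(\<Inter>i\<in>{..<d}. G i) \<subseteq> G 0" "(\<Inter>i\<in>{..<d}. G i) \<noteq> {}"
    using G(1) d0 by auto
  \<comment> \<open>\<open>W\<close> need not contain \<open>s\<close>; it is enough that it is
    affine, nonempty and inside every \<open>G i\<close>.\<close>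
  ultimately have "\<exists>W. affine_open S W \<and> W \<subseteq> (\<Inter>i\<in>{..<d}. G i) \<and> W \<noteq> {}"
    by (rule lie_generator_affine[OF gen[OF d0]])
  then obtain W where W: "affine_open S W" "W \<noteq> {}" and WG: "W \<subseteq> (\<Inter>i\<in>{..<d}. G i)"
    by blast
  have oW: "openin (sp S) W" using W(1) by (rule affine_openin)
  interpret R: cring "Sec S W" using oW by (rule sections_cring)
  have WGi: "W \<subseteq> G i" if "i < d" for i using WG that by blast
  define e where "e i = restrict (D i) (lie_dom S BT W)" for i
  have e_L: "e i \<in> ?L i W" if "i < d" for i
    unfolding e_def using Lie_part_restrict[OF pdiv_scheme_axioms \<iota> \<beta> D[OF that] G(2)[OF that] oW WGi[OF that]] .
  then have e_Lie: "e i \<in> Lie S BT W" if "i < d" for i using that L_Lie by blast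
  have coeff: "\<exists>c\<in>carrier (Sec S W). F = lie_smult S BT W c (e i)" if "i < d" "F \<in> ?L i W" for i F
    using lie_generator_coeff[OF gen[OF that(1)] oW WGi[OF that(1)] that(2)] unfolding e_def by metis
  have "\<exists>i<d. ?P W (e i) = lie_zero S BT W"
  proof (rule ccontr)
    assume "\<not> ?thesis"
    then have nz: "?P W (e i) \<noteq> lie_zero S BT W" if "i < d" for i using that by blast
    \<comment> \<open>\<open>c\<close> is the product of the coefficients met on the way down from
      index \<open>m\<close> to 0, one for each application of \<Pi>; it stays nonzero because the
      sections over \<open>W\<close> form a domain.\<close>
    have "\<exists>c\<in>carrier (Sec S W). c \<noteq> \<zero>\<^bsub>Sec S W\<^esub> \<and> (?P W ^^ m) (e m) = lie_smult S BT W c (e 0)"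
      if "m < d" for m
      using that
    proof (induction m)
      case 0
      then show ?case
        using lie_smult_one[OF oW e_Lie[OF d0]] sections_nontrivial[OF oW W(2)]
        by (intro bexI[of _ "\<one>\<^bsub>Sec S W\<^esub>"]) auto
    next
      case (Suc m)
      then obtain c where c: "c \<in> carrier (Sec S W)" "c \<noteq> \<zero>\<^bsub>Sec S W\<^esub>"
        "(?P W ^^ m) (e m) = lie_smult S BT W c (e 0)" by auto
      have "?P W (e (Suc m)) \<in> ?L m W"
        using Lie_part_shift[OF pdiv_scheme_axioms \<iota> e_L[OF Suc.prems]] .
      then obtain b where b: "b \<in> carrier (Sec S W)" "?P W (e (Suc m)) = lie_smult S BT W b (e m)"
        using coeff[of m] Suc.prems by auto
      then have "b \<noteq> \<zero>\<^bsub>Sec S W\<^esub>"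
        using nz[OF Suc.prems] lie_smult_zero[OF oW e_Lie[of m]] Suc.prems by auto
      then have "b \<otimes>\<^bsub>Sec S W\<^esub> c \<noteq> \<zero>\<^bsub>Sec S W\<^esub>"
        using affine_sections_integral[OF W(1) b(1) c(1)] c(2) by blast
      \<comment> \<open>Scalars pass through all iterates of \<Pi>, so the coefficient
        \<open>b\<close> of the innermost application comes out in front.\<close>
      moreover have "(?P W ^^ l) (lie_smult S BT W b F) = lie_smult S BT W b ((?P W ^^ l) F)" for l F
        by (induction l) (simp_all add: lie_map_smult[OF v])
      then have "(?P W ^^ Suc m) (e (Suc m)) = lie_smult S BT W (b \<otimes>\<^bsub>Sec S W\<^esub> c) (e 0)"
        using b c lie_smult_smult[OF oW b(1) c(1) e_Lie[OF d0]]
        by (simp add: funpow_Suc_right del: funpow.simps)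
      ultimately show ?case using b c by blast
    qed
    then obtain c where c: "c \<in> carrier (Sec S W)" "c \<noteq> \<zero>\<^bsub>Sec S W\<^esub>"
      "(?P W ^^ (d - 1)) (e (d - 1)) = lie_smult S BT W c (e 0)"
      using d0 by (meson diff_less zero_less_one)
    \<comment> \<open>One more \<Pi> after the d - 1 steps gives \<Pi>^d, which is 0 on Lie.\<close>
    have "lie_smult S BT W c (?P W (e 0)) = (?P W ^^ Suc (d - 1)) (e (d - 1))"
      using c(3) lie_map_smult[OF v] by simp
    also have "\<dots> = lie_zero S BT W"
      using lie_map_uniformizer_nilpotent[OF special \<kappa> oW e_Lie[of "d - 1"]] d0 by simp
    finally have cP: "lie_smult S BT W c (?P W (e 0)) = lie_zero S BT W" .
    have P0: "?P W (e 0) \<in> Lie S BT W" using Lie_lie_map[OF v e_Lie[OF d0]] .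
    \<comment> \<open>\<open>Lie_part_shift\<close> stops at index 0, so no coefficient is available
      for \<Pi> applied to \<open>e 0\<close>. Instead \<open>c\<close> is cancelled value by value:
      over a nonempty affine \<open>V\<close> its restriction is nonzero and the sections form a
      domain.\<close>
    have "?P W (e 0) = lie_zero S BT W"
    proof (rule extensionalityI)
      fix x assume x: "x \<in> lie_dom S BT W"
      obtain V a where xV: "x = (V, a)" by fastforce
      have V: "affine_open S V" "V \<subseteq> W" using x xV by (auto simp: lie_dom_def)
      have oV: "openin (sp S) V" using V(1) by (rule affine_openin)
      interpret WV: ring_hom_cring "Sec S W" "Sec S V" "Res S W V"
        using oW oV V by (intro res_ring_hom_cring)
      have y: "?P W (e 0) x \<in> carrier (Sec S V)" using Lie_value_closed[OF P0] x xV by simp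
      have "?P W (e 0) x = \<zero>\<^bsub>Sec S V\<^esub>"
      proof (cases "V = {}")
        case True
        then show ?thesis using y sections_empty WV.S.zero_closed by blast
      next
        case False
        then have "Res S W V c \<noteq> \<zero>\<^bsub>Sec S V\<^esub>"
          using affine_res_eq_zero[OF W(1) c(1) oV V(2)] c(2) by blast
        moreover have "Res S W V c \<otimes>\<^bsub>Sec S V\<^esub> ?P W (e 0) x = \<zero>\<^bsub>Sec S V\<^esub>"
          using fun_cong[OF cP, of x] x xV by (simp add: lie_smult_def lie_zero_def)
        ultimately show ?thesis
          using affine_sections_integral[OF V(1) _ y] WV.hom_closed[OF c(1)] by blast
      qed
      then show "?P W (e 0) x = lie_zero S BT W x" using x xV by (simp add: lie_zero_def)
    qed (auto simp: lie_map_def lie_zero_def)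
    then show False using nz[OF d0] by blast
  qed
  then obtain i where i: "i < d" and Pi: "?P W (e i) = lie_zero S BT W" by blast
  \<comment> \<open>Vanishing on \<open>W\<close> spreads to every nonempty affine \<open>V\<close>:
    by irreducibility \<open>V\<close> meets \<open>W\<close>, a small affine \<open>W'\<close> lies
    in both, \<open>F\<close> is a multiple of the generator there, and restriction from
    \<open>V\<close> to \<open>W'\<close> is injective.\<close>
  have "?P U F = lie_zero S BT U" if U: "openin (sp S) U" and F: "F \<in> ?L i U" for U F
  proof (rule extensionalityI)
    fix x assume x: "x \<in> lie_dom S BT U"
    obtain V a where xV: "x = (V, a)" by fastforce
    have V: "affine_open S V" "V \<subseteq> U" "a \<in> formal_functions BT V"
      using x xV by (auto simp: lie_dom_def)
    have oV: "openin (sp S) V" using V(1) by (rule affine_openin)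
    interpret V: cring "Sec S V" using oV by (rule sections_cring)
    have PF: "?P U F \<in> Lie S BT U" using Lie_lie_map[OF v] F L_Lie by blast
    have y: "?P U F x \<in> carrier (Sec S V)" using Lie_value_closed[OF PF] x xV by simp
    have "?P U F x = \<zero>\<^bsub>Sec S V\<^esub>"
    proof (cases "V = {}")
      case True
      then show ?thesis using y sections_empty V.zero_closed by blast
    next
      case False
      then have "V \<inter> W \<noteq> {}" using open_Int_nonempty oV oW W(2) by blast
      moreover have "openin (sp S) (V \<inter> W)" "V \<inter> W \<subseteq> G i" using oV oW WGi[OF i] by auto
      ultimately have "\<exists>W'. affine_open S W' \<and> W' \<subseteq> V \<inter> W \<and> W' \<noteq> {}"
        by (intro lie_generator_affine[OF gen[OF i]])
      then obtain W' where W': "affine_open S W'" "W' \<subseteq> V \<inter> W" "W' \<noteq> {}"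
        by blast
      then have W'U: "W' \<subseteq> U" using V(2) by blast
      have oW': "openin (sp S) W'" using W'(1) by (rule affine_openin)
      interpret W': cring "Sec S W'" using oW' by (rule sections_cring)
      let ?a = "\<lambda>n. Res (level BT n) V W' (a n)"
      have a': "(W', ?a) \<in> lie_dom S BT W'"
        using formal_functions_res[OF V(1) W'(1) _ V(3)] W' by (auto simp: lie_dom_def)
      have "restrict F (lie_dom S BT W') \<in> ?L i W'"
        using Lie_part_restrict[OF pdiv_scheme_axioms \<iota> \<beta> F U oW'] W'(2) V(2) by blast
      then obtain c where c: "c \<in> carrier (Sec S W')"
        "restrict F (lie_dom S BT W') = lie_smult S BT W' c (restrict (D i) (lie_dom S BT W'))"
        using lie_generator_coeff[OF gen[OF i] oW'] W'(2) WGi[OF i] by blast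
      have sub: "lie_dom S BT W' \<subseteq> lie_dom S BT W" "lie_dom S BT W' \<subseteq> lie_dom S BT U"
        using W'(2) V(2) by (auto intro!: lie_dom_mono)
      \<comment> \<open>Over \<open>W'\<close> the generator agrees with \<open>e i\<close>, whose
        image under \<Pi> is already known to vanish.\<close>
      have "restrict (D i) (lie_dom S BT W') = restrict (e i) (lie_dom S BT W')"
        using sub(1) by (auto simp: e_def restrict_def fun_eq_iff)
      then have "?P W' (restrict F (lie_dom S BT W'))
          = lie_smult S BT W' c (restrict (lie_zero S BT W) (lie_dom S BT W'))"
        using c(2) lie_map_smult[OF v] lie_map_restrict[OF v, of W' W "e i"] W'(2) Pi by simp
      then have "restrict (?P U F) (lie_dom S BT W') (W', ?a)
          = lie_smult S BT W' c (restrict (lie_zero S BT W) (lie_dom S BT W')) (W', ?a)"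
        using lie_map_restrict[OF v W'U, of F] by simp
      \<comment> \<open>\<open>lie_smult\<close> restricts its scalar even to the open set it lives
        on, hence this restriction from \<open>W'\<close> to itself.\<close>
      moreover have "Res S W' W' c \<in> carrier (Sec S W')"
        using ring_hom_closed[OF res_hom[OF oW' oW' subset_refl] c(1)] .
      ultimately have "?P U F (W', ?a) = \<zero>\<^bsub>Sec S W'\<^esub>"
        using a' sub by (auto simp: lie_smult_def lie_zero_def)
      then have "Res S V W' (?P U F x) = \<zero>\<^bsub>Sec S W'\<^esub>"
        using Lie_res[OF PF V(1) W'(1) _ V(2,3)] W'(2) xV by simp
      then show ?thesis
        using affine_res_eq_zero[OF V(1) y oW' _ W'(3)] W'(2) by blast
    qed
    then show "?P U F x = lie_zero S BT U x" using x xV by (simp add: lie_zero_def)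
  qed (auto simp: lie_map_def lie_zero_def)
  then show ?thesis using i by (auto simp: critical_index_def)
qed

end

theorem theorem5p13:
  fixes S :: "('s, 'a) ringed_space"
    and BT :: "('s, 'a, 'b) pdiv"
    and M :: "'m ring" and OD :: "'e ring" and k :: "'k ring"
  assumes "drinfeld_data p M z E w d Ed \<sigma> \<psi> OD j v k red"
    and "scheme_over k S \<kappa>"
    and "irreducible_space (sp S)"
    and "perfect_scheme p S"
    and "drinfeld_data.special_formal_module p M z E w d Ed \<sigma> \<psi> OD j S (\<kappa> \<circ> red) BT \<iota>"
  shows "\<exists>i<d. drinfeld_data.critical_index p M z Ed \<sigma> \<psi> j v S (\<kappa> \<circ> red) BT \<iota> i"
  using drinfeld_data.exists_critical_index[OF assms(1,5,2,3,4)] .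

end
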